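(* Let $p,q\ge1$ and let $\Sigma\subset\mathbb{Z}^N$ be simply connected. Let $f=s^+\oplus s^-:\Sigma\to\mathcal{Z}$ be an applicable Legendre map spanned by an isotropic Darboux pair of isothermic nets and set $s:=s^+\sqcup s^-:\{0,1\}\times\Sigma\to\mathcal{Q}$. For $t\in\mathbb{R}$ (different from every edge-label $m_{ij}$ of $s$), let $s(t)=s^+(t)\sqcup s^-(t)$ be the Calapso transform of $s$ and set $f(t):=s^+(t)\oplus s^-(t)$. Then $f(t):\Sigma\to\mathcal{Z}$ is an applicable Legendre map.
   Context: Domain: an edge $ij$ of $\Sigma\subset\mathbb{Z}^N$ is a pair of points of $\Sigma$ differing by a standard unit vector; a quadrilateral is an elementary square with all four vertices $i,j,k,\ell$ (in cyclic order) in $\Sigma$. $\Sigma$ is simply connected if any two points are joined by an edge-path in $\Sigma$ and any two edge-paths in $\Sigma$ with the same end-points are related by finitely many moves: (a) replace $i$ by $(iji)$ or conversely, $ij$ an edge; (b) replace $(k\ell i)$ by $(kji)$ on a quadrilateral. A vector-valued $1$-form $\alpha$ assigns $\alpha_{ji}=-\alpha_{ij}$ to each oriented edge from $i$ to $j$; it is closed if $\alpha_{i\ell}+\alpha_{\ell k}+\alpha_{kj}+\alpha_{ji}=0$ on every quadrilateral. $\mathbb{R}^{p+1,q+1}$ has a non-degenerate symmetric bilinear form $(\cdot,\cdot)$ of signature $(p+1,q+1)$, light cone $\mathcal{L}$ and quadric $\mathcal{Q}=\mathbb{P}(\mathcal{L})$; $\mathfrak{o}(p+1,q+1)\cong\Lambda^2\mathbb{R}^{p+1,q+1}$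 via $(a\wedge b)(z)=(a,z)b-(b,z)a$; $\mathcal{Z}$ is the set of totally null $2$-planes in $\mathbb{R}^{p+1,q+1}$. Isothermic nets: a map $s$ to $\mathcal{Q}$ (null line subbundle) is regular if on each quadrilateral $s_i,s_j,s_k,s_\ell$ are pairwise distinct, $\dim(s_i+s_j+s_k+s_\ell)\ge3$, and $s_i\not\perp s_k$, $s_j\not\perp s_\ell$. An isothermic net $(s,\eta)$ is a regular $s$ with a closed, never-zero $\Lambda^2\mathbb{R}^{p+1,q+1}$-valued $1$-form $\eta$ with $\eta_{ji}\in s_j\wedge s_i$ on each edge. A Moutard lift is a never-zero section $\mu$ of $s$ with $\eta_{ji}=\mu_j\wedge\mu_i$; the edge-labelling is $m_{ij}=1/(\mu_i,\mu_j)\in\mathbb{R}^\times\cup\{\infty\}$. All this applies also to nets on $\{0,1\}\times\Sigma\subset\mathbb{Z}^{N+1}$. For nets $s^\pm$ on $\Sigma$, $s^+\sqcup s^-:\{0,1\}\times\Sigma\to\mathcal{Q}$ equals $s^+$ on $\{0\}\times\Sigma$ and $s^-$ on $\{1\}\times\Sigma$. Isothermic nets $(s^\pm,\eta^\pm)$ are an isotropic Darboux pair if $s^+\sqcup s^-$ is isothermic with a $1$-form restricting to $\eta^\pm$ on the two copies of $\Sigma$ and all vertical edges $\{0,1\}\times\{i\}$ have edge-label $\infty$ (so $s^+_i\perp s^-_i$). Calapso transform: for an isothermic net $(s,\eta)$ with edge-labelling $m_{ij}$ and $t$ different from every $m_{ij}$, let $\Gamma^s(t)_{ji}\in\mathrm{O}(p+1,q+1)$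 be, if $m_{ij}\neq\infty$, the map acting as $1-t/m_{ij}$ on $s_j$, as $1$ on $(s_i\oplus s_j)^\perp$ and as $(1-t/m_{ij})^{-1}$ on $s_i$; and, if $m_{ij}=\infty$, $\exp(t\eta_{ji})$. This is a flat connection, so there is $T(t)$ with values in $\mathrm{O}(p+1,q+1)$ with $\Gamma^s(t)_{ji}=T(t)_j^{-1}T(t)_i$ on each edge. The Calapso transform of $s$ is $s(t)=T(t)s$, defined up to a constant element of $\mathrm{O}(p+1,q+1)$. Legendre maps: $f:\Sigma\to\mathcal{Z}$ with $f_i\cap f_j\ne\{0\}$ on each edge. Regular: (i) on each edge $f_{ij}:=f_i+f_j$ is $3$-dimensional, so $s_{ij}:=f_i\cap f_j$ is $1$-dimensional; (ii) on each quadrilateral $s_{ij}\wedge s_{jk}\wedge s_{k\ell}\wedge s_{\ell i}\ne\{0\}$. A regular $f$ is applicable if there is a closed $\Lambda^2\mathbb{R}^{p+1,q+1}$-valued $1$-form $\eta$ with $\eta_{ij}\in\Lambda^2f_{ij}$ and $\eta_{ij}\wedge s_{ij}\ne\{0\}$ on each edge. Regularity is a standing assumption imposed on all nets and Legendre maps considered, including $s(t)$ and $f(t)$. *)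

theory Defs
  imports "HOL-Analysis.Analysis"
begin

section \<open>Domains\<close>

text \<open>A point of \<open>\<int>\<^sup>N\<close> is an integer list of length \<open>N\<close>, so that \<open>{0,1} \<times> \<Sigma> \<subseteq> \<int>\<^sup>N\<^sup>+\<^sup>1\<close>
  is obtained by prepending a coordinate; \<open>shift a c i\<close> is \<open>i + c e\<^sub>a\<close>.\<close>

type_synonym point = "int list"

definition lattice_points :: "nat \<Rightarrow> point set" where
  "lattice_points N = {i. length i = N}"

definition shift :: "nat \<Rightarrow> int \<Rightarrow> point \<Rightarrow> point" where
  "shift a c i = i[a := i ! a + c]"

definition edge :: "point set \<Rightarrow> point \<Rightarrow> point \<Rightarrow> bool" where
  "edge \<Sigma> i j \<longleftrightarrow> i \<in> \<Sigma> \<and> j \<in> \<Sigma> \<and>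
     (\<exists>a < length i. j = shift a 1 i \<or> j = shift a (-1) i)"

definition quadrilateral :: "point set \<Rightarrow> point \<Rightarrow> point \<Rightarrow> point \<Rightarrow> point \<Rightarrow> bool" where
  "quadrilateral \<Sigma> i j k l \<longleftrightarrow> i \<in> \<Sigma> \<and> j \<in> \<Sigma> \<and> k \<in> \<Sigma> \<and> l \<in> \<Sigma> \<and>
     (\<exists>a < length i. \<exists>b < length i. \<exists>c \<in> {1, -1}. \<exists>d \<in> {1, -1}.
        a \<noteq> b \<and> j = shift a c i \<and> k = shift b d (shift a c i) \<and> l = shift b d i)"

definition edge_path :: "point set \<Rightarrow> point list \<Rightarrow> bool" where
  "edge_path \<Sigma> p \<longleftrightarrow> p \<noteq> [] \<and> set p \<subseteq> \<Sigma> \<and> successively (edge \<Sigma>) p"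

inductive path_move :: "point set \<Rightarrow> point list \<Rightarrow> point list \<Rightarrow> bool" for \<Sigma> where
  spike: "edge \<Sigma> i j \<Longrightarrow> path_move \<Sigma> (u @ [i] @ v) (u @ [i, j, i] @ v)"
| flip: "quadrilateral \<Sigma> i j k l \<Longrightarrow> path_move \<Sigma> (u @ [k, l, i] @ v) (u @ [k, j, i] @ v)"

definition simply_connected_domain :: "point set \<Rightarrow> bool" where
  "simply_connected_domain \<Sigma> \<longleftrightarrow>
     (\<forall>i\<in>\<Sigma>. \<forall>j\<in>\<Sigma>. \<exists>p. edge_path \<Sigma> p \<and> hd p = i \<and> last p = j) \<and>
     (\<forall>p r. edge_path \<Sigma> p \<and> edge_path \<Sigma> r \<and> hd p = hd r \<and> last p = last r
        \<longrightarrow> equivclp (path_move \<Sigma>) p r)"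

definition prism :: "point set \<Rightarrow> point set" where
  "prism \<Sigma> = {c # i | c i. c \<in> {0, 1} \<and> i \<in> \<Sigma>}"

definition join :: "(point \<Rightarrow> 'a) \<Rightarrow> (point \<Rightarrow> 'a) \<Rightarrow> point \<Rightarrow> 'a" (infix "\<squnion>\<^sub>n" 65) where
  "(sp \<squnion>\<^sub>n sm) x = (if hd x = 0 then sp (tl x) else sm (tl x))"

text \<open>A 1-form is written \<open>\<alpha> j i\<close> for \<open>\<alpha>\<^sub>j\<^sub>i\<close>, its value on the edge oriented from \<open>i\<close> to \<open>j\<close>.\<close>

definition one_form :: "point set \<Rightarrow> (point \<Rightarrow> point \<Rightarrow> 'w::ab_group_add) \<Rightarrow> bool" where
  "one_form \<Sigma> \<alpha> \<longleftrightarrow> (\<forall>i j. edge \<Sigma> i j \<longrightarrow> \<alpha> j i = - \<alpha> i j)"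

definition closed_form :: "point set \<Rightarrow> (point \<Rightarrow> point \<Rightarrow> 'w::ab_group_add) \<Rightarrow> bool" where
  "closed_form \<Sigma> \<alpha> \<longleftrightarrow>
     (\<forall>i j k l. quadrilateral \<Sigma> i j k l \<longrightarrow> \<alpha> i l + \<alpha> l k + \<alpha> k j + \<alpha> j i = 0)"

section \<open>The exterior algebra of \<open>\<real>\<^sup>n\<close>\<close>

text \<open>A multivector is given by its coefficients with respect to the basis
  \<open>e\<^sub>S = e\<^sub>s\<^sub>1 \<and> \<dots> \<and> e\<^sub>s\<^sub>k\<close> for \<open>S = {s1 < \<dots> < sk}\<close>, and
  \<open>e\<^sub>S \<and> e\<^sub>T = wedge_sign S T e\<^bsub>S \<union> T\<^esub>\<close>.\<close>

type_synonym 'n rvec = "(real, 'n) vec"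
type_synonym 'n multivector = "(real, 'n set) vec"

definition wedge_sign :: "'n::linorder set \<Rightarrow> 'n set \<Rightarrow> real" where
  "wedge_sign S T =
     (if S \<inter> T = {} then (-1) ^ card {(s, t). s \<in> S \<and> t \<in> T \<and> t < s} else 0)"

definition wedge ::
  "'n::{finite,linorder} multivector \<Rightarrow> 'n multivector \<Rightarrow> 'n multivector" (infixl "\<and>\<^sub>e" 70)
  where "x \<and>\<^sub>e y = (\<chi> U. \<Sum>S\<in>Pow U. wedge_sign S (U - S) * x $ S * y $ (U - S))"

definition mvec :: "'n rvec \<Rightarrow> 'n::{finite,linorder} multivector" where
  "mvec v = (\<Sum>i\<in>UNIV. v $ i *\<^sub>R axis {i} 1)"

definition wedge_span ::
  "'n::{finite,linorder} multivector set \<Rightarrow> 'n multivector set \<Rightarrow> 'n multivector set" where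
  "wedge_span X Y = span {x \<and>\<^sub>e y | x y. x \<in> X \<and> y \<in> Y}"

definition Lambda2 :: "'n rvec set \<Rightarrow> 'n::{finite,linorder} multivector set" where
  "Lambda2 W = wedge_span (mvec ` W) (mvec ` W)"

section \<open>Pseudo-Euclidean geometry\<close>

type_synonym 'n bform = "'n rvec \<Rightarrow> 'n rvec \<Rightarrow> real"
type_synonym 'n net = "point \<Rightarrow> 'n rvec set"
type_synonym 'n bivector_form = "point \<Rightarrow> point \<Rightarrow> 'n multivector"

definition has_signature :: "'n::finite bform \<Rightarrow> nat \<Rightarrow> nat \<Rightarrow> bool" where
  "has_signature B a b \<longleftrightarrow> bilinear B \<and> (\<forall>x y. B x y = B y x) \<and>
     (\<exists>P M. P \<inter> M = {} \<and> card P = a \<and> card M = b \<and>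
        independent (P \<union> M) \<and> span (P \<union> M) = UNIV \<and>
        (\<forall>x\<in>P. B x x = 1) \<and> (\<forall>x\<in>M. B x x = -1) \<and>
        (\<forall>x\<in>P \<union> M. \<forall>y\<in>P \<union> M. x \<noteq> y \<longrightarrow> B x y = 0))"

definition O_group :: "'n::finite bform \<Rightarrow> ('n rvec \<Rightarrow> 'n rvec) set" where
  "O_group B = {A. linear A \<and> bij A \<and> (\<forall>x y. B (A x) (A y) = B x y)}"

definition quadric :: "'n::finite bform \<Rightarrow> 'n rvec set set" where
  "quadric B = {L. subspace L \<and> dim L = 1 \<and> (\<forall>v\<in>L. B v v = 0)}"

definition null_planes :: "'n::finite bform \<Rightarrow> 'n rvec set set" where
  "null_planes B = {W. subspace W \<and> dim W = 2 \<and> (\<forall>v\<in>W. \<forall>w\<in>W. B v w = 0)}"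

definition perp :: "'n::finite bform \<Rightarrow> 'n rvec set \<Rightarrow> 'n rvec set \<Rightarrow> bool"
  where "perp B U W \<longleftrightarrow> (\<forall>u\<in>U. \<forall>w\<in>W. B u w = 0)"

definition perp_space ::
  "'n::finite bform \<Rightarrow> 'n rvec set \<Rightarrow> 'n rvec set" where
  "perp_space B U = {v. \<forall>u\<in>U. B u v = 0}"

text \<open>The isomorphism of the second exterior power with the skew endomorphisms: the linear
  extension of \<open>(a \<and> b) z = (a, z) b - (b, z) a\<close> from the basis \<open>e\<^sub>i \<and> e\<^sub>j\<close>, \<open>i < j\<close>
  (see lemma \<open>skew_map_wedge\<close> below).\<close>

definition skew_map ::
  "'n bform \<Rightarrow> 'n::{finite,linorder} multivector
     \<Rightarrow> 'n rvec \<Rightarrow> 'n rvec" where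
  "skew_map B \<omega> z = (\<Sum>i\<in>UNIV. \<Sum>j\<in>{i<..}. \<omega> $ {i, j} *\<^sub>R
     (B (axis i 1) z *\<^sub>R axis j 1 - B (axis j 1) z *\<^sub>R axis i 1))"

lemma mvec_nth: "mvec v $ S = (\<Sum>i\<in>UNIV. if S = {i} then v $ i else 0)"
  unfolding mvec_def by (auto simp: axis_def intro!: sum.cong)

lemma mvec_singleton [simp]: "mvec v $ {i} = v $ i"
proof -
  have "mvec v $ {i} = (\<Sum>k\<in>UNIV. if k = i then v $ k else 0)"
    unfolding mvec_nth by (intro sum.cong) auto
  then show ?thesis by simp
qed

lemma mvec_eq_0: "(\<And>i. S \<noteq> {i}) \<Longrightarrow> mvec v $ S = 0"
  by (simp add: mvec_nth)

lemma wedge_mvec_nth: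
  assumes "i < j"
  shows "(mvec a \<and>\<^sub>e mvec b) $ {i, j} = a $ i * b $ j - a $ j * b $ i"
proof -
  have P: "Pow {i, j} = {{}, {i}, {j}, {i, j}}" by auto
  have d: "{i, j} - {i} = {j}" "{i, j} - {j} = {i}" using assms by auto
  have w: "wedge_sign {i} {j} = 1" "wedge_sign {j} {i} = -1"
  proof -
    have c: "{(s, t). s \<in> {i} \<and> t \<in> {j} \<and> t < s} = {}"
      "{(s, t). s \<in> {j} \<and> t \<in> {i} \<and> t < s} = {(j, i)}"
      using assms by auto
    show "wedge_sign {i} {j} = 1" "wedge_sign {j} {i} = -1"
      unfolding wedge_sign_def c using assms by simp_all
  qed
  have z: "mvec a $ {} = 0" "mvec b $ {} = 0" by (auto intro: mvec_eq_0)
  have "(mvec a \<and>\<^sub>e mvec b) $ {i, j}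
      = (\<Sum>S\<in>{{}, {i}, {j}, {i, j}}. wedge_sign S ({i, j} - S) * mvec a $ S * mvec b $ ({i, j} - S))"
    unfolding wedge_def P[symmetric] by simp
  also have "\<dots> = a $ i * b $ j - a $ j * b $ i"
  proof -
    have ne: "{i} \<noteq> {j}" "{i} \<noteq> {i, j}" "{j} \<noteq> {i, j}" "{i, j} \<noteq> {}"
      using assms by auto
    show ?thesis
      using ne by (simp add: d w z del: insert_Diff_if insert_Diff1)
  qed
  finally show ?thesis .
qed

lemma skew_map_wedge:
  assumes "bilinear B"
  shows "skew_map B (mvec a \<and>\<^sub>e mvec b) z = B a z *\<^sub>R b - B b z *\<^sub>R a"
proof -
  define e where "e i = B (axis i 1) z" for i
  define g where "g i j = (a $ i * b $ j) *\<^sub>R (e i *\<^sub>R axis j 1 - e j *\<^sub>R axis i (1::real))" for i j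
  have lin: "linear (\<lambda>x. B x z)" using assms unfolding bilinear_def by auto
  have ex: "(\<Sum>i\<in>UNIV. x $ i *\<^sub>R axis i 1) = x" for x :: "'a rvec"
    using basis_expansion[of x] by (simp add: scalar_mult_eq_scaleR)
  have Bx: "B x z = (\<Sum>i\<in>UNIV. x $ i * e i)" for x
  proof -
    have "B x z = B (\<Sum>i\<in>UNIV. x $ i *\<^sub>R axis i 1) z" using ex by simp
    also have "\<dots> = (\<Sum>i\<in>UNIV. x $ i * e i)"
      by (simp add: linear_sum[OF lin] linear_cmul[OF lin] e_def)
    finally show ?thesis .
  qed
  have split: "(\<Sum>j\<in>UNIV. h j) = (\<Sum>j\<in>{i<..}. h j) + (\<Sum>j\<in>{..<i}. h j) + h i"
    for h :: "'a \<Rightarrow> 'a rvec" and i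
  proof -
    have "(\<Sum>j\<in>UNIV. h j) = (\<Sum>j\<in>insert i ({i<..} \<union> {..<i}). h j)"
      by (rule sum.cong) auto
    also have "\<dots> = h i + (\<Sum>j\<in>{i<..} \<union> {..<i}. h j)" by (subst sum.insert) auto
    also have "(\<Sum>j\<in>{i<..} \<union> {..<i}. h j) = (\<Sum>j\<in>{i<..}. h j) + (\<Sum>j\<in>{..<i}. h j)"
      by (rule sum.union_disjoint) auto
    finally show ?thesis by simp
  qed
  have "B a z *\<^sub>R b - B b z *\<^sub>R a
      = (\<Sum>i\<in>UNIV. a $ i * e i) *\<^sub>R (\<Sum>j\<in>UNIV. b $ j *\<^sub>R axis j 1)
        - (\<Sum>j\<in>UNIV. b $ j * e j) *\<^sub>R (\<Sum>i\<in>UNIV. a $ i *\<^sub>R axis i 1)"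
    using Bx ex by simp
  also have "\<dots> = (\<Sum>i\<in>UNIV. \<Sum>j\<in>UNIV. g i j)"
  proof -
    have pr: "(\<Sum>i\<in>UNIV. u i) *\<^sub>R (\<Sum>j\<in>UNIV. w j) = (\<Sum>i\<in>UNIV. \<Sum>j\<in>UNIV. u i *\<^sub>R w j)"
      for u :: "'a \<Rightarrow> real" and w :: "'a \<Rightarrow> 'a rvec"
      by (simp add: scaleR_sum_left) (simp add: scaleR_sum_right)
    have 1: "(\<Sum>i\<in>UNIV. a $ i * e i) *\<^sub>R (\<Sum>j\<in>UNIV. b $ j *\<^sub>R axis j 1)
      = (\<Sum>i\<in>UNIV. \<Sum>j\<in>UNIV. (a $ i * b $ j * e i) *\<^sub>R axis j (1::real))"
      unfolding pr by (simp add: mult_ac)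
    have "(\<Sum>j\<in>UNIV. b $ j * e j) *\<^sub>R (\<Sum>i\<in>UNIV. a $ i *\<^sub>R axis i 1)
      = (\<Sum>j\<in>UNIV. \<Sum>i\<in>UNIV. (a $ i * b $ j * e j) *\<^sub>R axis i (1::real))"
      unfolding pr by (simp add: mult_ac)
    also have "\<dots> = (\<Sum>i\<in>UNIV. \<Sum>j\<in>UNIV. (a $ i * b $ j * e j) *\<^sub>R axis i (1::real))"
      by (rule sum.swap)
    finally show ?thesis
      unfolding 1 g_def by (simp add: sum_subtractf scaleR_diff_right)
  qed
  also have "\<dots> = (\<Sum>i\<in>UNIV. \<Sum>j\<in>{i<..}. g i j) + (\<Sum>i\<in>UNIV. \<Sum>j\<in>{..<i}. g i j)"
  proof -
    have "(\<Sum>j\<in>UNIV. g i j) = (\<Sum>j\<in>{i<..}. g i j) + (\<Sum>j\<in>{..<i}. g i j)" for i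
      using split[of "g i" i] by (simp add: g_def[of i i])
    then show ?thesis by (simp add: sum.distrib)
  qed
  also have "(\<Sum>i\<in>UNIV. \<Sum>j\<in>{..<i}. g i j) = (\<Sum>i\<in>UNIV. \<Sum>j\<in>{i<..}. g j i)"
    using sum.swap_restrict[of UNIV UNIV g "\<lambda>i j. j < i"]
    by (simp add: lessThan_def greaterThan_def)
  finally have eq: "B a z *\<^sub>R b - B b z *\<^sub>R a = (\<Sum>i\<in>UNIV. \<Sum>j\<in>{i<..}. g i j + g j i)"
    by (simp add: sum.distrib)
  show ?thesis
    unfolding eq skew_map_def
    by (intro sum.cong refl)
      (simp add: wedge_mvec_nth g_def e_def algebra_simps)
qed

definition exp_map :: "('v::euclidean_space \<Rightarrow> 'v) \<Rightarrow> 'v \<Rightarrow> 'v" where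
  "exp_map A v = (\<Sum>n. (A ^^ n) v /\<^sub>R fact n)"

section \<open>Isothermic nets\<close>

definition regular_net ::
  "point set \<Rightarrow> 'n::finite bform \<Rightarrow> 'n net \<Rightarrow> bool" where
  "regular_net \<Sigma> B s \<longleftrightarrow> (\<forall>i j k l. quadrilateral \<Sigma> i j k l \<longrightarrow>
     distinct [s i, s j, s k, s l] \<and> dim (s i + s j + s k + s l) \<ge> 3 \<and>
     \<not> perp B (s i) (s k) \<and> \<not> perp B (s j) (s l))"

definition isothermic_net ::
  "point set \<Rightarrow> 'n bform \<Rightarrow> 'n net \<Rightarrow>
   'n::{finite,linorder} bivector_form \<Rightarrow> bool" where
  "isothermic_net \<Sigma> B s \<eta> \<longleftrightarrow>
     (\<forall>i\<in>\<Sigma>. s i \<in> quadric B) \<and> regular_net \<Sigma> B s \<and> one_form \<Sigma> \<eta> \<and> closed_form \<Sigma> \<eta> \<and>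
     (\<forall>i j. edge \<Sigma> i j \<longrightarrow> \<eta> j i \<noteq> 0 \<and> \<eta> j i \<in> wedge_span (mvec ` s j) (mvec ` s i))"

definition moutard_lift ::
  "point set \<Rightarrow> 'n net \<Rightarrow>
   'n::{finite,linorder} bivector_form \<Rightarrow> (point \<Rightarrow> 'n rvec) \<Rightarrow> bool" where
  "moutard_lift \<Sigma> s \<eta> \<mu> \<longleftrightarrow>
     (\<forall>i\<in>\<Sigma>. \<mu> i \<in> s i \<and> \<mu> i \<noteq> 0) \<and>
     (\<forall>i j. edge \<Sigma> i j \<longrightarrow> \<eta> j i = mvec (\<mu> j) \<and>\<^sub>e mvec (\<mu> i))"

text \<open>Over a simply connected domain an isothermic net has a Moutard lift, and the label does
  not depend on its choice, since two lifts differ on each edge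
  \<open>ij\<close> by factors \<open>r\<close> at \<open>i\<close> and \<open>1/r\<close> at \<open>j\<close>. Labels lie in \<open>\<real>\<^sup>\<times> \<union> {\<infinity>}\<close>, using that
  \<open>1 / 0 = \<infinity>\<close> in \<open>ereal\<close>; the value \<open>-\<infinity>\<close> does not occur.\<close>

definition edge_label ::
  "point set \<Rightarrow> 'n bform \<Rightarrow> 'n net \<Rightarrow>
   'n::{finite,linorder} bivector_form \<Rightarrow> point \<Rightarrow> point \<Rightarrow> ereal" where
  "edge_label \<Sigma> B s \<eta> i j =
     (let \<mu> = (SOME \<mu>. moutard_lift \<Sigma> s \<eta> \<mu>) in 1 / ereal (B (\<mu> i) (\<mu> j)))"

text \<open>The 1-form \<open>\<eta>\<close> of \<open>s\<^sup>+ \<squnion> s\<^sup>-\<close> is an explicit argument because the Calapso transform of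
  \<open>s\<^sup>+ \<squnion> s\<^sup>-\<close> depends on it.\<close>

definition isotropic_darboux_pair ::
  "point set \<Rightarrow> 'n bform \<Rightarrow>
   'n net \<Rightarrow> 'n::{finite,linorder} bivector_form \<Rightarrow>
   'n net \<Rightarrow> 'n bivector_form \<Rightarrow>
   'n bivector_form \<Rightarrow> bool" where
  "isotropic_darboux_pair \<Sigma> B sp \<eta>p sm \<eta>m \<eta> \<longleftrightarrow>
     isothermic_net \<Sigma> B sp \<eta>p \<and> isothermic_net \<Sigma> B sm \<eta>m \<and>
     isothermic_net (prism \<Sigma>) B (sp \<squnion>\<^sub>n sm) \<eta> \<and>
     (\<forall>i j. edge \<Sigma> i j \<longrightarrow> \<eta> (0 # j) (0 # i) = \<eta>p j i \<and> \<eta> (1 # j) (1 # i) = \<eta>m j i) \<and>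
     (\<forall>i\<in>\<Sigma>. edge_label (prism \<Sigma>) B (sp \<squnion>\<^sub>n sm) \<eta> (0 # i) (1 # i) = \<infinity>)"

section \<open>Calapso transforms\<close>

text \<open>\<open>calapso_connection \<Sigma> B s \<eta> t j i\<close> is \<open>\<Gamma>\<^sup>s(t)\<^sub>j\<^sub>i\<close>. For a finite label the three
  eigenspaces span the whole space, so that the description is definite.\<close>

definition calapso_connection ::
  "point set \<Rightarrow> 'n bform \<Rightarrow> 'n net \<Rightarrow>
   'n::{finite,linorder} bivector_form \<Rightarrow> real \<Rightarrow>
   point \<Rightarrow> point \<Rightarrow> 'n rvec \<Rightarrow> 'n rvec" where
  "calapso_connection \<Sigma> B s \<eta> t j i =
     (let m = edge_label \<Sigma> B s \<eta> i j; r = 1 - t / real_of_ereal m in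
      if m \<noteq> \<infinity> then
        (THE A. linear A \<and> (\<forall>v\<in>s j. A v = r *\<^sub>R v) \<and>
           (\<forall>v\<in>perp_space B (s i + s j). A v = v) \<and> (\<forall>v\<in>s i. A v = inverse r *\<^sub>R v))
      else exp_map (\<lambda>v. t *\<^sub>R skew_map B (\<eta> j i) v))"

definition calapso_gauge ::
  "point set \<Rightarrow> 'n bform \<Rightarrow> 'n net \<Rightarrow>
   'n::{finite,linorder} bivector_form \<Rightarrow> real \<Rightarrow>
   (point \<Rightarrow> 'n rvec \<Rightarrow> 'n rvec) \<Rightarrow> bool" where
  "calapso_gauge \<Sigma> B s \<eta> t T \<longleftrightarrow> (\<forall>i\<in>\<Sigma>. T i \<in> O_group B) \<and>
     (\<forall>i j. edge \<Sigma> i j \<longrightarrow> calapso_connection \<Sigma> B s \<eta> t j i = inv (T j) \<circ> T i)"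

section \<open>Legendre maps\<close>

definition legendre_map ::
  "point set \<Rightarrow> 'n::finite bform \<Rightarrow> 'n net \<Rightarrow> bool" where
  "legendre_map \<Sigma> B f \<longleftrightarrow> (\<forall>i\<in>\<Sigma>. f i \<in> null_planes B) \<and>
     (\<forall>i j. edge \<Sigma> i j \<longrightarrow> f i \<inter> f j \<noteq> {0})"

definition regular_legendre :: "point set \<Rightarrow> 'n::{finite,linorder} net \<Rightarrow> bool"
  where "regular_legendre \<Sigma> f \<longleftrightarrow>
     (\<forall>i j. edge \<Sigma> i j \<longrightarrow> dim (f i + f j) = 3) \<and>
     (\<forall>i j k l. quadrilateral \<Sigma> i j k l \<longrightarrow>
        wedge_span (wedge_span (wedge_span
          (mvec ` (f i \<inter> f j)) (mvec ` (f j \<inter> f k))) (mvec ` (f k \<inter> f l))) (mvec ` (f l \<inter> f i))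
        \<noteq> {0})"

definition applicable_legendre ::
  "point set \<Rightarrow> 'n bform \<Rightarrow>
   'n::{finite,linorder} net \<Rightarrow> bool" where
  "applicable_legendre \<Sigma> B f \<longleftrightarrow> legendre_map \<Sigma> B f \<and> regular_legendre \<Sigma> f \<and>
     (\<exists>\<eta> :: 'n bivector_form. one_form \<Sigma> \<eta> \<and> closed_form \<Sigma> \<eta> \<and>
        (\<forall>i j. edge \<Sigma> i j \<longrightarrow> \<eta> i j \<in> Lambda2 (f i + f j) \<and>
           wedge_span {\<eta> i j} (mvec ` (f i \<inter> f j)) \<noteq> {0}))"

end

theory Submission
  imports Defs
begin

text \<open>
  The proof rests on two facts about the Calapso connection of \<open>s = s\<^sup>+ \<squnion> s\<^sup>-\<close>, both read off from
  a Moutard lift \<open>\<mu>\<close> on the prism, \<open>\<eta>\<^sub>j\<^sub>i = \<mu>\<^sub>j \<and> \<mu>\<^sub>i\<close>. In terms of \<open>\<mu>\<close> both kinds of edges, finite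
  and infinite label, are governed by one formula,
  \<open>\<Gamma>\<^sub>j\<^sub>i v = v + t / (1 - t (\<mu>\<^sub>i, \<mu>\<^sub>j)) (\<mu>\<^sub>j, v) \<mu>\<^sub>i - t (\<mu>\<^sub>i, v) \<mu>\<^sub>j\<close>
  (\<open>calapso_step\<close>, \<open>calapso_gauge_steps\<close>).

  First, \<open>\<Gamma>\<^sub>j\<^sub>i\<close> fixes every vector orthogonal to \<open>\<mu>\<^sub>i\<close> and \<open>\<mu>\<^sub>j\<close>, so there \<open>T\<^sub>i\<close> and \<open>T\<^sub>j\<close> agree. As \<open>f\<^sub>i\<close>
  is totally null, the two maps over \<open>i\<close> agree on \<open>f\<^sub>i\<close>, so \<open>f(t)\<^sub>i\<close> is the image of \<open>f\<^sub>i\<close> under the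
  isometry \<open>T\<^sub>i\<close>, a null plane; and \<open>T\<^sub>i\<close>, \<open>T\<^sub>j\<close> agree on \<open>f\<^sub>i \<inter> f\<^sub>j\<close>, whose image therefore lies in
  \<open>f(t)\<^sub>i \<inter> f(t)\<^sub>j\<close>. Thus \<open>f(t)\<close> is a Legendre map.

  Second, \<open>T \<mu>\<close> satisfies, with the same coefficient, the Moutard equation
  \<open>\<mu>\<^sub>l - \<mu>\<^sub>j = c (\<mu>\<^sub>i - \<mu>\<^sub>k)\<close> satisfied by \<open>\<mu>\<close> on each quadrilateral (\<open>calapso_preserves_moutard\<close>).
  Hence \<open>T\<^sub>j\<mu>\<^sub>j \<and> T\<^sub>i\<mu>\<^sub>i\<close> is a closed form (\<open>calapso_transform_closed\<close>), and its restriction to the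
  copy of \<open>\<Sigma>\<close> that carries \<open>s\<^sup>+\<close> makes \<open>f(t)\<close> applicable. It pairs non-trivially with
  \<open>f(t)\<^sub>i \<inter> f(t)\<^sub>j\<close> because the diagonals of the vertical quadrilaterals are not orthogonal, whereas
  all of \<open>f\<^sub>i \<inter> f\<^sub>j\<close> is orthogonal to \<open>f\<^sub>i + f\<^sub>j\<close>.

  The existence of \<open>\<mu>\<close> comes first: a closed form taking values in \<open>s\<^sub>j \<and> s\<^sub>i\<close> has coefficients
  with trivial alternating product around each quadrilateral, so on the simply connected \<open>\<Sigma>\<close> they
  factorize (\<open>moutard_lift_exists\<close>), and the vertical quadrilaterals propagate the factorization to
  the other copy of \<open>\<Sigma>\<close> (\<open>moutard_lift_prism\<close>). Without a lift the edge-labels, and with them the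
  connection, would have no meaning.
\<close>

section \<open>Bivectors and trivectors in coordinates\<close>

lemma mvec_add: "mvec (a + b) = mvec a + mvec b"
  by (simp add: mvec_def scaleR_add_left sum.distrib)

lemma mvec_scaleR: "mvec (c *\<^sub>R a) = c *\<^sub>R mvec a"
  by (simp add: mvec_def scaleR_sum_right)

lemma mvec_diff: "mvec (a - b) = mvec a - mvec b"
  by (simp add: mvec_def scaleR_diff_left sum_subtractf)

lemma wedge_add_left: "(x + y) \<and>\<^sub>e z = x \<and>\<^sub>e z + y \<and>\<^sub>e z"
  by (simp add: wedge_def vec_eq_iff sum.distrib[symmetric] algebra_simps)

lemma wedge_add_right: "x \<and>\<^sub>e (y + z) = x \<and>\<^sub>e y + x \<and>\<^sub>e z"
  by (simp add: wedge_def vec_eq_iff sum.distrib[symmetric] algebra_simps)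

lemma wedge_scaleR_left: "(c *\<^sub>R x) \<and>\<^sub>e y = c *\<^sub>R (x \<and>\<^sub>e y)"
  by (simp add: wedge_def vec_eq_iff sum_distrib_left mult_ac)

lemma wedge_scaleR_right: "x \<and>\<^sub>e (c *\<^sub>R y) = c *\<^sub>R (x \<and>\<^sub>e y)"
  by (simp add: wedge_def vec_eq_iff sum_distrib_left mult_ac)

lemma wedge_diff_left: "(x - y) \<and>\<^sub>e z = x \<and>\<^sub>e z - y \<and>\<^sub>e z"
  using wedge_add_left[of "x - y" y z] by simp

lemma wedge_diff_right: "x \<and>\<^sub>e (y - z) = x \<and>\<^sub>e y - x \<and>\<^sub>e z"
  using wedge_add_right[of x "y - z" z] by simp

lemma wedge_mvec_right_nth:
  "(w \<and>\<^sub>e mvec v) $ U = (\<Sum>x\<in>U. wedge_sign (U - {x}) {x} * w $ (U - {x}) * v $ x)"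
proof -
  let ?g = "\<lambda>S. wedge_sign S (U - S) * w $ S * mvec v $ (U - S)"
  have "(w \<and>\<^sub>e mvec v) $ U = (\<Sum>S\<in>Pow U. ?g S)"
    by (simp add: wedge_def)
  also have "\<dots> = (\<Sum>S\<in>(\<lambda>x. U - {x}) ` U. ?g S)"
  proof (rule sum.mono_neutral_right)
    show "\<forall>S\<in>Pow U - (\<lambda>x. U - {x}) ` U. ?g S = 0"
    proof
      fix S assume S: "S \<in> Pow U - (\<lambda>x. U - {x}) ` U"
      have "U - S \<noteq> {x}" for x
      proof
        assume "U - S = {x}"
        then have "x \<in> U" "S = U - {x}" using S by auto
        then show False using S by auto
      qed
      then show "?g S = 0" by (simp add: mvec_eq_0)
    qed
  qed auto
  also have "\<dots> = (\<Sum>x\<in>U. ?g (U - {x}))"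
    by (subst sum.reindex) (auto simp: inj_on_def)
  also have "\<dots> = (\<Sum>x\<in>U. wedge_sign (U - {x}) {x} * w $ (U - {x}) * v $ x)"
  proof (rule sum.cong)
    fix x assume "x \<in> U"
    then have "U - (U - {x}) = {x}" by auto
    then show "?g (U - {x}) = wedge_sign (U - {x}) {x} * w $ (U - {x}) * v $ x"
      by simp
  qed simp
  finally show ?thesis .
qed

lemma wedge_sign_singleton:
  fixes U :: "'n::{finite,linorder} set"
  shows "wedge_sign (U - {x}) {x} = (-1) ^ card {s \<in> U. x < s}"
proof -
  have "{(s, t). s \<in> U - {x} \<and> t \<in> {x} \<and> t < s} = (\<lambda>s. (s, x)) ` {s \<in> U. x < s}"
    by auto
  then have "card {(s, t). s \<in> U - {x} \<and> t \<in> {x} \<and> t < s} = card {s \<in> U. x < s}"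
    by (simp add: card_image inj_on_def)
  then show ?thesis by (simp add: wedge_sign_def)
qed

lemma wedge_mvec_self: "mvec a \<and>\<^sub>e mvec a = 0"
proof -
  have "(mvec a \<and>\<^sub>e mvec a) $ U = 0" for U
  proof (cases "\<exists>i j. i < j \<and> U = {i, j}")
    case True
    then show ?thesis by (auto simp: wedge_mvec_nth)
  next
    case False
    have "U - {x} \<noteq> {y}" if "x \<in> U" for x y
    proof
      assume "U - {x} = {y}"
      then have "U = {x, y}" "x \<noteq> y" using that by auto
      then show False using False by (metis insert_commute linorder_neqE)
    qed
    then have "mvec a $ (U - {x}) = 0" if "x \<in> U" for x
      using that by (auto intro: mvec_eq_0)
    then show ?thesis by (simp add: wedge_mvec_right_nth)
  qed
  then show ?thesis by (simp add: vec_eq_iff)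
qed

lemma wedge_mvec_anti: "mvec a \<and>\<^sub>e mvec b = - (mvec b \<and>\<^sub>e mvec a)"
proof -
  have "mvec (a + b) \<and>\<^sub>e mvec (a + b) = 0" by (rule wedge_mvec_self)
  then show ?thesis
    by (simp add: mvec_add wedge_add_left wedge_add_right wedge_mvec_self
        add_eq_0_iff)
qed

lemma wedge_mvec_eq_0_coords:
  assumes "mvec a \<and>\<^sub>e mvec b = 0"
  shows "a $ i * b $ j = a $ j * b $ i"
proof -
  have "a $ i * b $ j - a $ j * b $ i = 0" if "i < j" for i j
    using wedge_mvec_nth[OF that, of a b] assms by simp
  from this[of i j] this[of j i] show ?thesis
    by (cases i j rule: linorder_cases) auto
qed

lemma wedge_mvec_eq_0_imp_multiple:
  assumes "mvec a \<and>\<^sub>e mvec b = 0" and "a \<noteq> 0"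
  obtains c where "b = c *\<^sub>R a"
proof -
  from assms(2) obtain i where i: "a $ i \<noteq> 0" by (auto simp: vec_eq_iff)
  have "b = (b $ i / a $ i) *\<^sub>R a"
    using wedge_mvec_eq_0_coords[OF assms(1), of i] i
    by (simp add: vec_eq_iff field_simps)
  then show ?thesis by (rule that)
qed

text \<open>The coefficients of the trivector are the \<open>3 \<times> 3\<close> minors of \<open>a, b, v\<close>. If they all vanish,
  expanding a minor along \<open>v\<close>, with two of its indices fixed such that \<open>a \<and> b\<close> has a non-zero
  coefficient there, displays a linear relation.\<close>

lemma wedge3_mvec_eq_0_imp_dependent:
  assumes "mvec a \<and>\<^sub>e mvec b \<and>\<^sub>e mvec v = 0"
  obtains x y z where "x *\<^sub>R a + y *\<^sub>R b + z *\<^sub>R v = 0" and "\<not> (x = 0 \<and> y = 0 \<and> z = 0)"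
proof -
  define D where "D i j = a $ i * b $ j - a $ j * b $ i" for i j
  define F where "F i j k = D i j * v $ k + D j k * v $ i + D k i * v $ j" for i j k
  have F_less: "F i j k = 0" if ij: "i < j" and jk: "j < k" for i j k
  proof -
    let ?U = "{i, j, k}"
    have ne: "i \<noteq> j" "j \<noteq> k" "i \<noteq> k" and ik: "i < k" using ij jk by auto
    have diff: "?U - {i} = {j, k}" "?U - {j} = {i, k}" "?U - {k} = {i, j}"
      using ne by auto
    have above: "{s \<in> ?U. i < s} = {j, k}" "{s \<in> ?U. j < s} = {k}" "{s \<in> ?U. k < s} = {}"
      using ij jk by auto
    have sign: "wedge_sign (?U - {i}) {i} = 1" "wedge_sign (?U - {j}) {j} = -1"
        "wedge_sign (?U - {k}) {k} = 1"
      unfolding wedge_sign_singleton above using ne by simp_all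
    have "0 = (mvec a \<and>\<^sub>e mvec b \<and>\<^sub>e mvec v) $ ?U" using assms by simp
    also have "\<dots> = (\<Sum>x\<in>?U. wedge_sign (?U - {x}) {x} * (mvec a \<and>\<^sub>e mvec b) $ (?U - {x}) * v $ x)"
      by (rule wedge_mvec_right_nth)
    also have "\<dots> = D j k * v $ i - D i k * v $ j + D i j * v $ k"
      using ne sign unfolding D_def wedge_mvec_nth[OF ij, symmetric] wedge_mvec_nth[OF jk, symmetric]
        wedge_mvec_nth[OF ik, symmetric]
      by (simp add: diff del: insert_Diff_if insert_Diff1)
    finally show ?thesis by (simp add: F_def D_def algebra_simps)
  qed
  \<comment> \<open>\<open>F\<close> is alternating, so it vanishes on all triples of indices as soon as it does on increasing ones.\<close>
  have F_swap: "F j i k = - F i j k" and F_rot: "F j k i = F i j k" and F_diag: "F i i k = 0" for i j k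
    by (simp_all add: F_def D_def algebra_simps)
  have F0: "F i j k = 0" for i j k
  proof -
    consider "i = j" | "j = k" | "i = k" | "i < j" "j < k" | "j < k" "k < i" | "k < i" "i < j"
      | "j < i" "i < k" | "i < k" "k < j" | "k < j" "j < i"
      by (metis linorder_neqE)
    then show ?thesis
      by cases (metis F_diag, metis F_diag F_rot, metis F_diag F_rot,
          metis F_less, metis F_less F_rot, metis F_less F_rot,
          (metis F_less F_rot F_swap neg_equal_0_iff_equal)+)
  qed
  show ?thesis
  proof (cases "\<exists>i j. D i j \<noteq> 0")
    case True
    then obtain i j where ij: "D i j \<noteq> 0" by blast
    have "(b $ i * v $ j - b $ j * v $ i) *\<^sub>R a + (a $ j * v $ i - a $ i * v $ j) *\<^sub>R b
        + D i j *\<^sub>R v = 0"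
      using F0[of i j] by (simp add: vec_eq_iff F_def D_def algebra_simps)
    then show ?thesis using ij that by blast
  next
    case False
    show ?thesis
    proof (cases "a = 0")
      case True
      then show ?thesis using that[of 1 0 0] by simp
    next
      case a: False
      then obtain i where i: "a $ i \<noteq> 0" by (auto simp: vec_eq_iff)
      have "b $ i *\<^sub>R a + (- a $ i) *\<^sub>R b + 0 *\<^sub>R v = 0"
        using False by (simp add: vec_eq_iff D_def algebra_simps)
      then show ?thesis using i that[of "b $ i" "- a $ i" 0] by simp
    qed
  qed
qed

text \<open>The sum of the values of a Moutard form around a quadrilateral is the wedge of its diagonals;
  closedness therefore means that the diagonals are parallel, which is the Moutard equation.\<close>

lemma wedge_quad_factor:
  "mvec i \<and>\<^sub>e mvec l + mvec l \<and>\<^sub>e mvec k + mvec k \<and>\<^sub>e mvec j + mvec j \<and>\<^sub>e mvec i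
    = mvec (i - k) \<and>\<^sub>e mvec (l - j)"
  unfolding mvec_diff wedge_diff_left wedge_diff_right
  using wedge_mvec_anti[of l k] wedge_mvec_anti[of j i] by (simp add: algebra_simps)

text \<open>Collecting the terms in \<open>i\<close> and in \<open>k\<close> turns the hypothesis into \<open>i \<and> u = k \<and> w\<close> with
  \<open>u, w\<close> in the span of \<open>l, j\<close>. As \<open>i\<close> and \<open>k\<close> are independent, \<open>u\<close> and \<open>w\<close> lie in the span of
  \<open>i, k\<close>. If the determinant \<open>ail akj - aji alk\<close> of \<open>u, w\<close> with respect to \<open>l, j\<close> did not vanish,
  then \<open>l\<close> and \<open>j\<close> would lie there too.\<close>

lemma quad_coefficient_relation:
  fixes i j k l :: "'n::{finite,linorder} rvec"
  assumes closed: "ail *\<^sub>R (mvec i \<and>\<^sub>e mvec l) + alk *\<^sub>R (mvec l \<and>\<^sub>e mvec k)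
      + akj *\<^sub>R (mvec k \<and>\<^sub>e mvec j) + aji *\<^sub>R (mvec j \<and>\<^sub>e mvec i) = 0"
    and indep: "mvec i \<and>\<^sub>e mvec k \<noteq> 0"
    and notin: "\<not> (l \<in> span {i, k} \<and> j \<in> span {i, k})"
  shows "ail * akj = aji * alk"
proof (rule ccontr)
  assume ne: "ail * akj \<noteq> aji * alk"
  define u where "u = ail *\<^sub>R l - aji *\<^sub>R j"
  define w where "w = alk *\<^sub>R l - akj *\<^sub>R j"
  have eq: "mvec i \<and>\<^sub>e mvec u = mvec k \<and>\<^sub>e mvec w"
    using closed wedge_mvec_anti[of l k] wedge_mvec_anti[of j i]
    unfolding u_def w_def mvec_diff mvec_scaleR wedge_diff_right wedge_scaleR_right
    by (simp add: algebra_simps)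
  have bil: "bilinear (\<lambda>x y::'n rvec. x \<bullet> y)"
    by (simp add: bilinear_def linear_iff inner_simps)
  have contract: "(i \<bullet> z) *\<^sub>R u - (u \<bullet> z) *\<^sub>R i = (k \<bullet> z) *\<^sub>R w - (w \<bullet> z) *\<^sub>R k" for z
    using skew_map_wedge[OF bil, of i u z] skew_map_wedge[OF bil, of k w z] eq by simp
  have mem: "x \<in> span {i, k}" if "\<And>z. (p \<bullet> z) *\<^sub>R x - (x \<bullet> z) *\<^sub>R p = (q \<bullet> z) *\<^sub>R y - (y \<bullet> z) *\<^sub>R q"
    and pq: "{p, q} = {i, k}" and pq0: "mvec p \<and>\<^sub>e mvec q \<noteq> 0" for p q x y
  proof -
    \<comment> \<open>Contracting with the part of \<open>p\<close> orthogonal to \<open>q\<close> isolates \<open>x\<close>.\<close>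
    define z where "z = (q \<bullet> q) *\<^sub>R p - (p \<bullet> q) *\<^sub>R q"
    have qz: "q \<bullet> z = 0" by (simp add: z_def inner_simps inner_commute)
    have "z \<noteq> 0"
    proof
      assume "z = 0"
      then have "(q \<bullet> q) *\<^sub>R (mvec p \<and>\<^sub>e mvec q) = (p \<bullet> q) *\<^sub>R (mvec q \<and>\<^sub>e mvec q)"
        by (metis z_def mvec_scaleR wedge_scaleR_left eq_iff_diff_eq_0)
      then have "q = 0" using pq0 by (simp add: wedge_mvec_self)
      then show False using pq0 mvec_scaleR[of 0 q] wedge_scaleR_right[of "mvec p" 0 0] by simp
    qed
    moreover have "z \<bullet> z = (q \<bullet> q) * (p \<bullet> z)"
    proof -
      have "z \<bullet> z = ((q \<bullet> q) *\<^sub>R p - (p \<bullet> q) *\<^sub>R q) \<bullet> z" by (simp add: z_def)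
      then show ?thesis using qz by (simp add: inner_diff_left)
    qed
    ultimately have pz: "p \<bullet> z \<noteq> 0" by auto
    have "(p \<bullet> z) *\<^sub>R x = (x \<bullet> z) *\<^sub>R p - (y \<bullet> z) *\<^sub>R q"
      using that(1)[of z] qz by (simp add: algebra_simps)
    moreover have "(x \<bullet> z) *\<^sub>R p - (y \<bullet> z) *\<^sub>R q \<in> span {i, k}"
      unfolding pq[symmetric] by (intro span_diff span_scale span_base) auto
    ultimately have "(1 / (p \<bullet> z)) *\<^sub>R ((p \<bullet> z) *\<^sub>R x) \<in> span {i, k}"
      by (metis span_scale)
    then show ?thesis using pz by simp
  qed
  have u: "u \<in> span {i, k}" using mem[OF contract] indep by blast
  have w: "w \<in> span {i, k}"
    using mem[OF contract[symmetric]] indep wedge_mvec_anti[of k i] by auto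
  define \<delta> where "\<delta> = ail * akj - aji * alk"
  have \<delta>: "\<delta> \<noteq> 0" using ne by (simp add: \<delta>_def)
  have "akj *\<^sub>R u - aji *\<^sub>R w = \<delta> *\<^sub>R l" "alk *\<^sub>R u - ail *\<^sub>R w = \<delta> *\<^sub>R j"
    by (simp_all add: u_def w_def \<delta>_def algebra_simps)
  then have "\<delta> *\<^sub>R l \<in> span {i, k}" "\<delta> *\<^sub>R j \<in> span {i, k}"
    using u w by (metis span_diff span_scale)+
  then have "(1/\<delta>) *\<^sub>R (\<delta> *\<^sub>R l) \<in> span {i, k}" "(1/\<delta>) *\<^sub>R (\<delta> *\<^sub>R j) \<in> span {i, k}"
    by (metis span_scale)+
  then show False using notin \<delta> by simp
qed

section \<open>Edges and quadrilaterals\<close>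

lemma length_shift [simp]: "length (shift a c i) = length i"
  by (simp add: shift_def)

lemma shift_shift: "a < length i \<Longrightarrow> shift a c (shift a d i) = shift a (c + d) i"
  by (simp add: shift_def add.assoc add.commute[of c])

lemma shift_0 [simp]: "shift a 0 i = i"
  by (simp add: shift_def)

lemma shift_commute: "a \<noteq> b \<Longrightarrow> shift a c (shift b d i) = shift b d (shift a c i)"
  by (simp add: shift_def list_update_swap)

lemma shift_Cons_0: "shift 0 c (x # i) = (x + c) # i"
  by (simp add: shift_def)

lemma shift_Cons_Suc: "shift (Suc a) c (x # i) = x # shift a c i"
  by (simp add: shift_def)

lemma edge_iff: "edge \<Sigma> i j \<longleftrightarrow> i \<in> \<Sigma> \<and> j \<in> \<Sigma> \<and>
    (\<exists>a < length i. \<exists>c \<in> {1, -1}. j = shift a c i)"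
  by (auto simp: edge_def)

lemma edge_sym: "edge \<Sigma> i j \<Longrightarrow> edge \<Sigma> j i"
proof -
  assume e: "edge \<Sigma> i j"
  then obtain a c where a: "a < length i" "c \<in> {1, -1}" "j = shift a c i"
    by (auto simp: edge_iff)
  then have "a < length j" "- c \<in> {1, -1}" "i = shift a (- c) j"
    by (auto simp: shift_shift)
  then show ?thesis using e unfolding edge_iff by blast
qed

lemma edge_in: "edge \<Sigma> i j \<Longrightarrow> i \<in> \<Sigma>" "edge \<Sigma> i j \<Longrightarrow> j \<in> \<Sigma>"
  by (auto simp: edge_def)

lemma quadrilateral_edges:
  assumes "quadrilateral \<Sigma> i j k l"
  shows "edge \<Sigma> i j" "edge \<Sigma> j k" "edge \<Sigma> l k" "edge \<Sigma> i l"
proof -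
  from assms obtain a b c d where
    *: "i \<in> \<Sigma>" "j \<in> \<Sigma>" "k \<in> \<Sigma>" "l \<in> \<Sigma>" "a < length i" "b < length i"
      "c \<in> {1, -1}" "d \<in> {1, -1}" "a \<noteq> b"
      "j = shift a c i" "k = shift b d (shift a c i)" "l = shift b d i"
    unfolding quadrilateral_def by blast
  have k: "k = shift b d j" "k = shift a c l" using * by (auto simp: shift_commute)
  have len: "length j = length i" "length l = length i" using * by auto
  show "edge \<Sigma> i j" "edge \<Sigma> i l" using * unfolding edge_iff by blast+
  show "edge \<Sigma> j k" using * k(1) len unfolding edge_iff by metis
  show "edge \<Sigma> l k" using * k(2) len unfolding edge_iff by metis
qed

lemma prism_Cons [simp]: "c # i \<in> prism \<Sigma> \<longleftrightarrow> c \<in> {0, 1} \<and> i \<in> \<Sigma>"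
  by (auto simp: prism_def)

lemma edge_prism_horizontal: "edge \<Sigma> i j \<Longrightarrow> c \<in> {0, 1} \<Longrightarrow> edge (prism \<Sigma>) (c # i) (c # j)"
  unfolding edge_iff by (force simp: shift_Cons_Suc)

lemma edge_prism_vertical: "i \<in> \<Sigma> \<Longrightarrow> edge (prism \<Sigma>) (0 # i) (1 # i)"
  unfolding edge_def by (auto simp: shift_Cons_0 intro!: exI[of _ 0])

lemma edge_prism_cases:
  assumes "edge (prism \<Sigma>) x y"
  obtains (horizontal) c i j where "c \<in> {0, 1}" "x = c # i" "y = c # j" "edge \<Sigma> i j"
  | (up) i where "i \<in> \<Sigma>" "x = 0 # i" "y = 1 # i"
  | (down) i where "i \<in> \<Sigma>" "x = 1 # i" "y = 0 # i"
proof -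
  from assms obtain a e where x: "x \<in> prism \<Sigma>" and y: "y \<in> prism \<Sigma>"
    and a: "a < length x" and e: "e \<in> {1, -1}" and yx: "y = shift a e x"
    by (auto simp: edge_iff)
  from x obtain c i where c: "c \<in> {0, 1}" and i: "i \<in> \<Sigma>" and xc: "x = c # i"
    by (auto simp: prism_def)
  show thesis
  proof (cases a)
    case 0
    then have "y = (c + e) # i" using yx xc by (simp add: shift_Cons_0)
    then show ?thesis using y c e i xc up down by auto
  next
    case (Suc b)
    then have yb: "y = c # shift b e i" using yx xc by (simp add: shift_Cons_Suc)
    then have "edge \<Sigma> i (shift b e i)"
      using y i a Suc xc e unfolding edge_iff by auto
    then show ?thesis using horizontal c xc yb by blast
  qed
qed

lemma quadrilateral_prism_horizontal:
  assumes "quadrilateral \<Sigma> i j k l" and "c \<in> {0, 1}"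
  shows "quadrilateral (prism \<Sigma>) (c # i) (c # j) (c # k) (c # l)"
proof -
  from assms obtain a b e d where
    *: "i \<in> \<Sigma>" "j \<in> \<Sigma>" "k \<in> \<Sigma>" "l \<in> \<Sigma>" "a < length i" "b < length i"
      "e \<in> {1, -1}" "d \<in> {1, -1}" "a \<noteq> b"
      "j = shift a e i" "k = shift b d (shift a e i)" "l = shift b d i"
    unfolding quadrilateral_def by blast
  have "Suc a < length (c # i)" "Suc b < length (c # i)" "Suc a \<noteq> Suc b"
    "c # j = shift (Suc a) e (c # i)" "c # k = shift (Suc b) d (shift (Suc a) e (c # i))"
    "c # l = shift (Suc b) d (c # i)"
    using * by (auto simp: shift_Cons_Suc)
  then show ?thesis using * assms(2) unfolding quadrilateral_def prism_Cons by blast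
qed

lemma quadrilateral_prism_vertical:
  assumes "edge \<Sigma> i j"
  shows "quadrilateral (prism \<Sigma>) (0 # i) (0 # j) (1 # j) (1 # i)"
proof -
  from assms obtain a e where *: "i \<in> \<Sigma>" "j \<in> \<Sigma>" "a < length i" "e \<in> {1, -1}" "j = shift a e i"
    by (auto simp: edge_iff)
  have "Suc a < length (0 # i)" "0 < length (0 # i)" "Suc a \<noteq> 0"
    "0 # j = shift (Suc a) e (0 # i)" "1 # j = shift 0 1 (shift (Suc a) e (0 # i))"
    "1 # i = shift 0 1 (0 # i)"
    using * by (auto simp: shift_Cons_Suc shift_Cons_0)
  moreover have "(1::int) \<in> {1, -1}" by simp
  ultimately show ?thesis using * unfolding quadrilateral_def prism_Cons by blast
qed

section \<open>Moutard lifts\<close>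

text \<open>Solving \<open>r\<^sub>j r\<^sub>i = a\<^sub>j\<^sub>i\<close> along a path, starting with the value \<open>r\<close> at its first point; the
  result is the value at the last point.\<close>

fun alternating_transport :: "('p \<Rightarrow> 'p \<Rightarrow> real) \<Rightarrow> 'p list \<Rightarrow> real \<Rightarrow> real" where
  "alternating_transport a (i # j # p) r = alternating_transport a (j # p) (a j i / r)"
| "alternating_transport a p r = r"

lemma alternating_transport_append:
  "alternating_transport a (p @ i # q) r
    = alternating_transport a (i # q) (alternating_transport a (p @ [i]) r)"
proof (induction p arbitrary: r)
  case (Cons j p)
  then show ?case by (cases p) auto
qed simp

text \<open>Transport along a spike \<open>i j i\<close> is \<open>r \<mapsto> a / (a / r) = r\<close>, and the two ways around a
  quadrilateral multiply \<open>r\<close> by \<open>a\<^sub>i\<^sub>l / a\<^sub>l\<^sub>k\<close> and \<open>a\<^sub>i\<^sub>j / a\<^sub>j\<^sub>k\<close>. The moves preserve the parity of the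
  length of a path, so the alternation does no harm.\<close>

lemma alternating_transport_path_move:
  assumes "path_move \<Sigma> p p'"
    and sym: "\<And>i j. edge \<Sigma> i j \<Longrightarrow> a i j = a j i \<and> a i j \<noteq> 0"
    and quad: "\<And>i j k l. quadrilateral \<Sigma> i j k l \<Longrightarrow> a i l * a k j = a j i * a l k"
  shows "alternating_transport a p r = alternating_transport a p' r"
  using assms(1)
proof cases
  case (spike i j u v)
  then show ?thesis
    using sym[OF spike(3)]
      alternating_transport_append[of a u i v r] alternating_transport_append[of a u i "j # i # v" r]
    by simp
next
  case (flip i j k l u v)
  let ?r = "alternating_transport a (u @ [k]) r"
  have "a i l / (a l k / ?r) = a i j / (a j k / ?r)"
    using quad[OF flip(3)] quadrilateral_edges[OF flip(3), THEN sym]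
    by (simp add: field_simps)
  then show ?thesis
    using alternating_transport_append[of a u k "l # i # v" r]
      alternating_transport_append[of a u k "j # i # v" r] flip
    by simp
qed

lemma alternating_transport_nonzero:
  assumes "successively (edge \<Sigma>) p" and "r \<noteq> 0"
    and "\<And>i j. edge \<Sigma> i j \<Longrightarrow> a i j = a j i \<and> a i j \<noteq> 0"
  shows "alternating_transport a p r \<noteq> 0"
  using assms(1,2)
proof (induction p arbitrary: r)
  case (Cons i p)
  show ?case
  proof (cases p)
    case (Cons j q)
    then show ?thesis using Cons.IH[of "a j i / r"] Cons.prems assms(3)[of i j] by simp
  qed (use Cons.prems in simp)
qed simp

text \<open>A multiplicative Poincare lemma: by invariance under moves, transport from a base point
  depends on the end-point only.\<close>

lemma edge_function_factorizes:
  fixes a :: "point \<Rightarrow> point \<Rightarrow> real"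
  assumes sc: "simply_connected_domain \<Sigma>"
    and sym: "\<And>i j. edge \<Sigma> i j \<Longrightarrow> a i j = a j i \<and> a i j \<noteq> 0"
    and quad: "\<And>i j k l. quadrilateral \<Sigma> i j k l \<Longrightarrow> a i l * a k j = a j i * a l k"
  obtains r where "\<And>i. i \<in> \<Sigma> \<Longrightarrow> r i \<noteq> 0" and "\<And>i j. edge \<Sigma> i j \<Longrightarrow> a j i = r j * r i"
proof (cases "\<Sigma> = {}")
  case True
  then show ?thesis using that[of "\<lambda>_. 1"] by (auto simp: edge_def)
next
  case False
  then obtain i\<^sub>0 where base: "i\<^sub>0 \<in> \<Sigma>" by blast
  have "\<forall>i\<in>\<Sigma>. \<exists>p. edge_path \<Sigma> p \<and> hd p = i\<^sub>0 \<and> last p = i"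
    using sc base unfolding simply_connected_domain_def by blast
  then obtain P where P: "\<And>i. i \<in> \<Sigma> \<Longrightarrow> edge_path \<Sigma> (P i) \<and> hd (P i) = i\<^sub>0 \<and> last (P i) = i"
    by metis
  define r where "r i = alternating_transport a (P i) 1" for i
  have r0: "r i \<noteq> 0" if "i \<in> \<Sigma>" for i
    unfolding r_def using P[OF that] sym
    by (intro alternating_transport_nonzero) (auto simp: edge_path_def)
  have invariant: "alternating_transport a p 1 = alternating_transport a p' 1"
    if "equivclp (path_move \<Sigma>) p p'" for p p'
    using that
    by (induction rule: equivclp_induct)
      (metis alternating_transport_path_move[of \<Sigma> _ _ a, OF _ sym quad])+
  have "a j i = r j * r i" if e: "edge \<Sigma> i j" for i j
  proof -
    have i: "i \<in> \<Sigma>" and j: "j \<in> \<Sigma>" using e edge_in by auto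
    have Pi: "P i = butlast (P i) @ [i]"
      using P[OF i] by (metis append_butlast_last_id edge_path_def)
    have "edge_path \<Sigma> (P i @ [j])" "hd (P i @ [j]) = i\<^sub>0" "last (P i @ [j]) = j"
      using P[OF i] e j by (auto simp: edge_path_def successively_append_iff)
    then have "equivclp (path_move \<Sigma>) (P i @ [j]) (P j)"
      using sc P[OF j] unfolding simply_connected_domain_def by metis
    then have "r j = alternating_transport a (P i @ [j]) 1"
      unfolding r_def by (metis invariant)
    also have "\<dots> = a j i / r i"
      using alternating_transport_append[of a "butlast (P i)" i "[j]" 1] Pi
      by (metis append.assoc append_Cons append_Nil alternating_transport.simps(1,3) r_def)
    finally show ?thesis using r0[OF i] by simp
  qed
  then show ?thesis using that r0 by blast
qed

lemma quadric_eq_span: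
  assumes "L \<in> quadric B" and "v \<in> L" and "v \<noteq> 0"
  shows "L = span {v}"
proof -
  have L: "subspace L" "dim L = 1" using assms by (auto simp: quadric_def)
  have "span {v} = span L"
    by (rule subspace_dim_equal) (use assms L in \<open>auto simp: span_mono\<close>)
  then show ?thesis using L by (metis span_eq_iff)
qed

lemma quadric_nonzero_exists:
  assumes "L \<in> quadric B" shows "\<exists>v\<in>L. v \<noteq> 0"
proof (rule ccontr)
  assume "\<not> ?thesis"
  then have "L \<subseteq> {0}" by blast
  then have "dim L = 0" by (simp add: dim_eq_0)
  moreover have "dim L = 1" using assms by (simp add: quadric_def)
  ultimately show False by linarith
qed

lemma wedge_span_lines:
  "wedge_span (mvec ` span {a}) (mvec ` span {b}) = span {mvec a \<and>\<^sub>e mvec b}"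
proof
  show "wedge_span (mvec ` span {a}) (mvec ` span {b}) \<subseteq> span {mvec a \<and>\<^sub>e mvec b}"
    unfolding wedge_span_def
    by (rule span_minimal[OF _ subspace_span])
      (auto simp: span_singleton mvec_scaleR wedge_scaleR_left wedge_scaleR_right)
  show "span {mvec a \<and>\<^sub>e mvec b} \<subseteq> wedge_span (mvec ` span {a}) (mvec ` span {b})"
    unfolding wedge_span_def by (rule span_mono) (auto intro: span_base)
qed

lemma isothermic_coefficients:
  assumes iso: "isothermic_net \<Sigma> B s \<eta>"
    and lift: "\<And>i. i \<in> \<Sigma> \<Longrightarrow> \<sigma> i \<in> s i \<and> \<sigma> i \<noteq> 0"
  obtains a where "\<And>i j. edge \<Sigma> i j \<Longrightarrow> \<eta> j i = a j i *\<^sub>R (mvec (\<sigma> j) \<and>\<^sub>e mvec (\<sigma> i))"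
proof
  fix i j assume e: "edge \<Sigma> i j"
  have "s x = span {\<sigma> x}" if "x \<in> \<Sigma>" for x
    using iso that lift quadric_eq_span unfolding isothermic_net_def by blast
  then have "\<eta> j i \<in> span {mvec (\<sigma> j) \<and>\<^sub>e mvec (\<sigma> i)}"
    using iso e edge_in[OF e] wedge_span_lines unfolding isothermic_net_def by metis
  then have "\<exists>c. \<eta> j i = c *\<^sub>R (mvec (\<sigma> j) \<and>\<^sub>e mvec (\<sigma> i))"
    by (auto simp: span_singleton)
  then show "\<eta> j i = (SOME c. \<eta> j i = c *\<^sub>R (mvec (\<sigma> j) \<and>\<^sub>e mvec (\<sigma> i)))
      *\<^sub>R (mvec (\<sigma> j) \<and>\<^sub>e mvec (\<sigma> i))"
    by (rule someI_ex)
qed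

lemma isothermic_quad_relation:
  assumes iso: "isothermic_net \<Sigma> B s \<eta>"
    and lift: "\<And>i. i \<in> \<Sigma> \<Longrightarrow> \<sigma> i \<in> s i \<and> \<sigma> i \<noteq> 0"
    and coeff: "\<And>i j. edge \<Sigma> i j \<Longrightarrow> \<eta> j i = a j i *\<^sub>R (mvec (\<sigma> j) \<and>\<^sub>e mvec (\<sigma> i))"
    and quad: "quadrilateral \<Sigma> i j k l"
  shows "a i l * a k j = a j i * a l k"
proof (rule quad_coefficient_relation)
  note e = quadrilateral_edges[OF quad]
  have in\<Sigma>: "i \<in> \<Sigma>" "j \<in> \<Sigma>" "k \<in> \<Sigma>" "l \<in> \<Sigma>"
    using quad by (auto simp: quadrilateral_def)
  have sp: "s x = span {\<sigma> x}" if "x \<in> \<Sigma>" for x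
    using iso that lift quadric_eq_span unfolding isothermic_net_def by blast
  have "\<eta> i l + \<eta> l k + \<eta> k j + \<eta> j i = 0"
    using iso quad unfolding isothermic_net_def closed_form_def by blast
  then show "a i l *\<^sub>R (mvec (\<sigma> i) \<and>\<^sub>e mvec (\<sigma> l)) + a l k *\<^sub>R (mvec (\<sigma> l) \<and>\<^sub>e mvec (\<sigma> k))
      + a k j *\<^sub>R (mvec (\<sigma> k) \<and>\<^sub>e mvec (\<sigma> j)) + a j i *\<^sub>R (mvec (\<sigma> j) \<and>\<^sub>e mvec (\<sigma> i)) = 0"
    using coeff[OF e(1)] coeff[OF e(2)] coeff[OF edge_sym[OF e(3)]] coeff[OF edge_sym[OF e(4)]]
    by simp
  have reg: "distinct [s i, s j, s k, s l]" "dim (s i + s j + s k + s l) \<ge> 3"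
    using iso quad unfolding isothermic_net_def regular_net_def by blast+
  show "mvec (\<sigma> i) \<and>\<^sub>e mvec (\<sigma> k) \<noteq> 0"
  proof
    assume "mvec (\<sigma> i) \<and>\<^sub>e mvec (\<sigma> k) = 0"
    then obtain c where "\<sigma> k = c *\<^sub>R \<sigma> i"
      using wedge_mvec_eq_0_imp_multiple lift in\<Sigma> by metis
    then have "\<sigma> k \<in> s i" using sp[of i] in\<Sigma> by (auto simp: span_singleton)
    then have "s i = span {\<sigma> k}"
      using iso in\<Sigma> lift quadric_eq_span unfolding isothermic_net_def by blast
    then show False using reg(1) sp[of k] in\<Sigma> by simp
  qed
  show "\<not> (\<sigma> l \<in> span {\<sigma> i, \<sigma> k} \<and> \<sigma> j \<in> span {\<sigma> i, \<sigma> k})"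
  proof
    assume lj: "\<sigma> l \<in> span {\<sigma> i, \<sigma> k} \<and> \<sigma> j \<in> span {\<sigma> i, \<sigma> k}"
    have "s x \<subseteq> span {\<sigma> i, \<sigma> k}" if "x \<in> {i, j, k, l}" for x
    proof -
      have "\<sigma> x \<in> span {\<sigma> i, \<sigma> k}" using that lj by (auto intro: span_base)
      then have "span {\<sigma> x} \<subseteq> span {\<sigma> i, \<sigma> k}" by (intro span_minimal) auto
      then show ?thesis using sp[of x] that in\<Sigma> by auto
    qed
    then have "s i + s j + s k + s l \<subseteq> span {\<sigma> i, \<sigma> k}"
      by (auto simp: set_plus_def subset_iff intro!: span_add)
    then have "dim (s i + s j + s k + s l) \<le> card {\<sigma> i, \<sigma> k}"
      by (metis dim_le_card finite.emptyI finite.insertI)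
    also have "\<dots> \<le> 2" by (simp add: card_insert_if)
    finally show False using reg(2) by simp
  qed
qed

theorem moutard_lift_exists:
  assumes sc: "simply_connected_domain \<Sigma>" and iso: "isothermic_net \<Sigma> B s \<eta>"
  shows "\<exists>\<mu>. moutard_lift \<Sigma> s \<eta> \<mu>"
proof -
  have "\<forall>i\<in>\<Sigma>. \<exists>v\<in>s i. v \<noteq> 0"
    using iso quadric_nonzero_exists unfolding isothermic_net_def by blast
  then obtain \<sigma> where \<sigma>: "\<And>i. i \<in> \<Sigma> \<Longrightarrow> \<sigma> i \<in> s i \<and> \<sigma> i \<noteq> 0" by metis
  have sp: "s i = span {\<sigma> i}" if "i \<in> \<Sigma>" for i
    using iso that \<sigma> quadric_eq_span unfolding isothermic_net_def by blast
  obtain a where a: "\<And>i j. edge \<Sigma> i j \<Longrightarrow> \<eta> j i = a j i *\<^sub>R (mvec (\<sigma> j) \<and>\<^sub>e mvec (\<sigma> i))"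
    using isothermic_coefficients[OF iso \<sigma>] by blast
  have sym: "a i j = a j i \<and> a i j \<noteq> 0" if e: "edge \<Sigma> i j" for i j
  proof -
    have ne: "\<eta> j i \<noteq> 0" and neg: "\<eta> j i = - \<eta> i j"
      using iso e unfolding isothermic_net_def one_form_def by blast+
    have "a j i *\<^sub>R (mvec (\<sigma> j) \<and>\<^sub>e mvec (\<sigma> i)) = a i j *\<^sub>R (mvec (\<sigma> j) \<and>\<^sub>e mvec (\<sigma> i))"
      using neg a[OF e] a[OF edge_sym[OF e]] wedge_mvec_anti[of "\<sigma> i" "\<sigma> j"] by simp
    then show ?thesis using ne a[OF e] by auto
  qed
  obtain r where r: "\<And>i. i \<in> \<Sigma> \<Longrightarrow> r i \<noteq> 0" "\<And>i j. edge \<Sigma> i j \<Longrightarrow> a j i = r j * r i"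
    using edge_function_factorizes[OF sc, of a] sym isothermic_quad_relation[OF iso \<sigma> a] by metis
  have "moutard_lift \<Sigma> s \<eta> (\<lambda>i. r i *\<^sub>R \<sigma> i)"
    unfolding moutard_lift_def
  proof (intro conjI ballI allI impI)
    fix i assume i: "i \<in> \<Sigma>"
    show "r i *\<^sub>R \<sigma> i \<in> s i" unfolding sp[OF i] by (simp add: span_base span_scale)
    show "r i *\<^sub>R \<sigma> i \<noteq> 0" using r \<sigma> i by simp
  next
    fix i j assume "edge \<Sigma> i j"
    then show "\<eta> j i = mvec (r j *\<^sub>R \<sigma> j) \<and>\<^sub>e mvec (r i *\<^sub>R \<sigma> i)"
      using a r by (simp add: mvec_scaleR wedge_scaleR_left wedge_scaleR_right mult.commute)
  qed
  then show ?thesis by blast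
qed

lemma moutard_lift_line:
  assumes "isothermic_net \<Sigma> B s \<eta>" and "moutard_lift \<Sigma> s \<eta> \<mu>" and "i \<in> \<Sigma>"
  shows "s i = span {\<mu> i}" and "B (\<mu> i) (\<mu> i) = 0"
  using assms quadric_eq_span[of "s i" B "\<mu> i"]
  unfolding isothermic_net_def moutard_lift_def quadric_def by blast+

text \<open>Let \<open>\<mu>\<close> on the upper copy be fixed by the vertical edges. On a vertical quadrilateral three of
  the four coefficients of \<open>\<eta>\<close> with respect to \<open>\<mu>\<close> are then \<open>1\<close>, so the fourth, that of the upper
  edge, is \<open>1\<close> too.\<close>

lemma moutard_lift_prism:
  assumes lift: "moutard_lift \<Sigma> sp \<eta>p \<mu>p"
    and base: "\<And>i j. edge \<Sigma> i j \<Longrightarrow> \<eta> (0 # j) (0 # i) = \<eta>p j i"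
    and iso: "isothermic_net (prism \<Sigma>) B (sp \<squnion>\<^sub>n sm) \<eta>"
  shows "\<exists>\<mu>. moutard_lift (prism \<Sigma>) (sp \<squnion>\<^sub>n sm) \<eta> \<mu>"
proof -
  let ?s = "sp \<squnion>\<^sub>n sm"
  have quadric: "?s x \<in> quadric B" if "x \<in> prism \<Sigma>" for x
    using iso that unfolding isothermic_net_def by blast
  have \<eta>_in: "\<eta> y x \<noteq> 0 \<and> \<eta> y x \<in> wedge_span (mvec ` ?s y) (mvec ` ?s x)"
    and \<eta>_anti: "\<eta> y x = - \<eta> x y" if "edge (prism \<Sigma>) x y" for x y
    using iso that unfolding isothermic_net_def one_form_def by blast+
  have \<mu>p: "\<mu>p i \<in> sp i \<and> \<mu>p i \<noteq> 0" if "i \<in> \<Sigma>" for i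
    using lift that unfolding moutard_lift_def by blast
  have "\<exists>v\<in>sm i. v \<noteq> 0 \<and> \<eta> (1 # i) (0 # i) = mvec v \<and>\<^sub>e mvec (\<mu>p i)" if i: "i \<in> \<Sigma>" for i
  proof -
    have "sm i \<in> quadric B" "sp i \<in> quadric B"
      using quadric[of "1 # i"] quadric[of "0 # i"] i by (simp_all add: join_def)
    moreover obtain w where w: "w \<in> sm i" "w \<noteq> 0"
      using calculation quadric_nonzero_exists by blast
    ultimately have sm: "sm i = span {w}" and sp: "sp i = span {\<mu>p i}"
      using quadric_eq_span \<mu>p[OF i] by blast+
    have "\<eta> (1 # i) (0 # i) \<in> span {mvec w \<and>\<^sub>e mvec (\<mu>p i)}"
      using \<eta>_in[OF edge_prism_vertical[OF i]] sm sp by (simp add: join_def wedge_span_lines)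
    then obtain c where c: "\<eta> (1 # i) (0 # i) = c *\<^sub>R (mvec w \<and>\<^sub>e mvec (\<mu>p i))"
      by (auto simp: span_singleton)
    moreover have "c \<noteq> 0" using c \<eta>_in[OF edge_prism_vertical[OF i]] by auto
    ultimately show ?thesis
      using w sm by (intro bexI[of _ "c *\<^sub>R w"])
        (auto simp: mvec_scaleR wedge_scaleR_left span_base span_scale)
  qed
  then obtain \<mu>m where \<mu>m: "\<And>i. i \<in> \<Sigma> \<Longrightarrow>
      \<mu>m i \<in> sm i \<and> \<mu>m i \<noteq> 0 \<and> \<eta> (1 # i) (0 # i) = mvec (\<mu>m i) \<and>\<^sub>e mvec (\<mu>p i)"
    by metis
  define \<mu> where "\<mu> = \<mu>p \<squnion>\<^sub>n \<mu>m"
  have \<mu>: "\<mu> x \<in> ?s x \<and> \<mu> x \<noteq> 0" if "x \<in> prism \<Sigma>" for x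
    using that \<mu>p \<mu>m by (auto simp: prism_def \<mu>_def join_def)
  obtain a where a: "\<And>x y. edge (prism \<Sigma>) x y \<Longrightarrow> \<eta> y x = a y x *\<^sub>R (mvec (\<mu> y) \<and>\<^sub>e mvec (\<mu> x))"
    using isothermic_coefficients[OF iso \<mu>] by blast
  have a_1: "a y x = 1" if e: "edge (prism \<Sigma>) x y"
    and "\<eta> y x = mvec (\<mu> y) \<and>\<^sub>e mvec (\<mu> x)" for x y
  proof -
    have "a y x *\<^sub>R (mvec (\<mu> y) \<and>\<^sub>e mvec (\<mu> x)) = 1 *\<^sub>R (mvec (\<mu> y) \<and>\<^sub>e mvec (\<mu> x))"
      using a[OF e] that(2) by simp
    moreover have "mvec (\<mu> y) \<and>\<^sub>e mvec (\<mu> x) \<noteq> 0" using \<eta>_in[OF e] that(2) by simp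
    ultimately show ?thesis by (simp only: scaleR_cancel_right) simp
  qed
  have up: "\<eta> (1 # i) (0 # i) = mvec (\<mu> (1 # i)) \<and>\<^sub>e mvec (\<mu> (0 # i))" if "i \<in> \<Sigma>" for i
    using \<mu>m[OF that] by (simp add: \<mu>_def join_def)
  have down: "\<eta> (0 # i) (1 # i) = mvec (\<mu> (0 # i)) \<and>\<^sub>e mvec (\<mu> (1 # i))" if "i \<in> \<Sigma>" for i
    using up[OF that] \<eta>_anti[OF edge_sym[OF edge_prism_vertical[OF that]]]
      wedge_mvec_anti[of "\<mu> (0 # i)" "\<mu> (1 # i)"] by simp
  have bottom: "\<eta> (0 # j) (0 # i) = mvec (\<mu> (0 # j)) \<and>\<^sub>e mvec (\<mu> (0 # i))"
    if "edge \<Sigma> i j" for i j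
    using lift base[OF that] that by (simp add: moutard_lift_def \<mu>_def join_def)
  have top: "\<eta> (1 # j) (1 # i) = mvec (\<mu> (1 # j)) \<and>\<^sub>e mvec (\<mu> (1 # i))" if e: "edge \<Sigma> i j" for i j
  proof -
    note q = quadrilateral_prism_vertical[OF edge_sym[OF e]]
    have ij: "i \<in> \<Sigma>" "j \<in> \<Sigma>" using edge_in[OF e] by auto
    have "a (0 # j) (1 # j) * a (1 # i) (0 # i) = a (0 # i) (0 # j) * a (1 # j) (1 # i)"
      by (rule isothermic_quad_relation[OF iso \<mu> a q])
    moreover have "a (0 # j) (1 # j) = 1" "a (1 # i) (0 # i) = 1"
      "a (0 # i) (0 # j) = 1"
      using a_1[OF edge_sym[OF edge_prism_vertical[OF ij(2)]] down[OF ij(2)]]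
        a_1[OF edge_prism_vertical[OF ij(1)] up[OF ij(1)]]
        a_1[OF edge_prism_horizontal[OF edge_sym[OF e], of 0] bottom[OF edge_sym[OF e]]]
      by simp_all
    ultimately show ?thesis using a[OF edge_prism_horizontal[OF e, of 1]] by simp
  qed
  have "moutard_lift (prism \<Sigma>) ?s \<eta> \<mu>"
    unfolding moutard_lift_def
  proof (intro conjI ballI allI impI)
    fix x y assume "edge (prism \<Sigma>) x y"
    then show "\<eta> y x = mvec (\<mu> y) \<and>\<^sub>e mvec (\<mu> x)"
      by (cases rule: edge_prism_cases) (use up down bottom top in auto)
  qed (use \<mu> in auto)
  then show ?thesis by blast
qed

section \<open>The Calapso connection\<close>

text \<open>With \<open>u = \<mu>\<^sub>i\<close> and \<open>w = \<mu>\<^sub>j\<close> this is \<open>\<Gamma>\<^sub>j\<^sub>i\<close>, for every value of \<open>B u w = 1 / m\<^sub>i\<^sub>j\<close>: for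
  null \<open>u, w\<close> with \<open>B u w = 0\<close> it is \<open>id + t (w \<and> u)\<close>, the exponential of a map of square zero.\<close>

definition calapso_step :: "'n::finite bform \<Rightarrow> real \<Rightarrow> 'n rvec \<Rightarrow> 'n rvec \<Rightarrow> 'n rvec \<Rightarrow> 'n rvec" where
  "calapso_step B t u w v =
     v + (t / (1 - t * B u w) * B w v) *\<^sub>R u - (t * B u v) *\<^sub>R w"

lemma exp_map_square_zero:
  assumes "A 0 = 0" and "\<And>v. A (A v) = 0"
  shows "exp_map A v = v + A v"
proof -
  have "(A ^^ (n + 2)) v = 0" for n
    by (induction n) (use assms in \<open>auto simp: numeral_2_eq_2\<close>)
  then have "(A ^^ n) v = 0" if "n \<ge> 2" for n
    using that by (metis le_add_diff_inverse2)
  then have "(\<Sum>n. (A ^^ n) v /\<^sub>R fact n) = (\<Sum>n\<in>{0, 1}. (A ^^ n) v /\<^sub>R fact n)"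
    by (intro suminf_finite) auto
  then show ?thesis by (simp add: exp_map_def)
qed

lemmas bilinear_rules =
  bilinear_ladd bilinear_radd bilinear_lsub bilinear_rsub bilinear_lmul bilinear_rmul

lemma linear_calapso_step:
  assumes "bilinear B"
  shows "linear (calapso_step B t u w)"
  by (rule linearI)
    (simp_all add: calapso_step_def bilinear_rules[OF assms] add_divide_distrib algebra_simps)

lemma calapso_step_self:
  assumes sym: "\<And>x y. B x y = B y x" and "B u u = 0" and "t * B u w \<noteq> 1"
  shows "calapso_step B t u w u = (1 / (1 - t * B u w)) *\<^sub>R u"
proof -
  have "1 / (1 - t * B u w) = 1 + t / (1 - t * B u w) * B w u"
    using assms(3) sym[of w u] by (simp add: field_simps)
  then have "(1 / (1 - t * B u w)) *\<^sub>R u = u + (t / (1 - t * B u w) * B w u) *\<^sub>R u"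
    by (simp only: scaleR_add_left scaleR_one)
  then show ?thesis using assms(2) by (simp add: calapso_step_def)
qed

text \<open>If \<open>u\<close> and \<open>w\<close> are null and not orthogonal, every vector is a combination of \<open>u\<close>, \<open>w\<close> and a
  vector orthogonal to both, so the three eigenspaces determine the map.\<close>

lemma calapso_eigenmap_unique:
  fixes B :: "'n::finite bform"
  assumes bil: "bilinear B" and sym: "\<And>x y. B x y = B y x"
    and null: "B u u = 0" "B w w = 0" and a: "B u w \<noteq> 0" and t: "t * B u w \<noteq> 1"
  shows "(THE A. linear A \<and> (\<forall>v\<in>span {w}. A v = (1 - t * B u w) *\<^sub>R v) \<and>
      (\<forall>v\<in>perp_space B (span {u} + span {w}). A v = v) \<and>
      (\<forall>v\<in>span {u}. A v = inverse (1 - t * B u w) *\<^sub>R v)) = calapso_step B t u w"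
    (is "(THE A. ?P A) = _")
proof (rule the_equality)
  let ?r = "1 - t * B u w"
  have r: "?r \<noteq> 0" using t by simp
  have wu: "B w u = B u w" by (rule sym)
  have "calapso_step B t u w w = ?r *\<^sub>R w" "calapso_step B t u w u = inverse ?r *\<^sub>R u"
    using calapso_step_self[OF sym null(1) t] null(2) wu
    by (simp_all add: calapso_step_def algebra_simps inverse_eq_divide)
  moreover have "calapso_step B t u w v = v" if "v \<in> perp_space B (span {u} + span {w})" for v
  proof -
    have "u + 0 \<in> span {u} + span {w}" "0 + w \<in> span {u} + span {w}"
      by (intro set_plus_intro span_base span_zero; simp)+
    then have "B u v = 0" "B w v = 0" using that by (auto simp: perp_space_def)
    then show ?thesis by (simp add: calapso_step_def)
  qed
  ultimately show "?P (calapso_step B t u w)"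
    using linear_calapso_step[OF bil, of t u w]
    by (auto simp: span_singleton linear_cmul)
  fix A assume A: "?P A"
  show "A = calapso_step B t u w"
  proof
    fix v
    define x where "x = B w v / B u w"
    define y where "y = B u v / B u w"
    define z where "z = v - x *\<^sub>R u - y *\<^sub>R w"
    have Bz: "B u z = 0" "B w z = 0"
      using a by (simp_all add: z_def bilinear_rules[OF bil] null wu x_def y_def)
    then have "z \<in> perp_space B (span {u} + span {w})"
      by (auto simp: perp_space_def set_plus_def span_singleton bilinear_rules[OF bil])
    then have "A z = z" "A u = inverse ?r *\<^sub>R u" "A w = ?r *\<^sub>R w"
      using A by (auto simp: span_base)
    moreover have "v = x *\<^sub>R u + y *\<^sub>R w + z" by (simp add: z_def)
    ultimately have "A v = x *\<^sub>R (inverse ?r *\<^sub>R u) + y *\<^sub>R (?r *\<^sub>R w) + z"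
      using A by (simp add: linear_add linear_cmul)
    also have "\<dots> = v + (x * (inverse ?r - 1)) *\<^sub>R u + (y * (?r - 1)) *\<^sub>R w"
      by (simp add: z_def algebra_simps)
    also have "x * (inverse ?r - 1) = t / ?r * B w v"
      using r a by (simp add: x_def field_simps)
    also have "y * (?r - 1) = - (t * B u v)"
      using a by (simp add: y_def)
    finally show "A v = calapso_step B t u w v"
      by (simp add: calapso_step_def)
  qed
qed

text \<open>The lift is the one that underlies the edge-labels, so that
  \<open>1 / m\<^sub>i\<^sub>j = (\<mu>\<^sub>i, \<mu>\<^sub>j)\<close>; that \<open>t\<close> avoids the labels becomes \<open>t (\<mu>\<^sub>i, \<mu>\<^sub>j) \<noteq> 1\<close>.\<close>

lemma calapso_gauge_steps:
  fixes B :: "'n::{finite,linorder} bform"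
  assumes bil: "bilinear B" and sym: "\<And>x y. B x y = B y x"
    and iso: "isothermic_net \<Sigma> B s \<eta>"
    and ex: "\<exists>\<mu>. moutard_lift \<Sigma> s \<eta> \<mu>"
    and t: "\<And>i j. edge \<Sigma> i j \<Longrightarrow> ereal t \<noteq> edge_label \<Sigma> B s \<eta> i j"
    and gauge: "calapso_gauge \<Sigma> B s \<eta> t T"
  obtains \<mu> where "moutard_lift \<Sigma> s \<eta> \<mu>"
    and "\<And>i j. edge \<Sigma> i j \<Longrightarrow> t * B (\<mu> i) (\<mu> j) \<noteq> 1"
    and "\<And>i j v. edge \<Sigma> i j \<Longrightarrow> T i v = T j (calapso_step B t (\<mu> i) (\<mu> j) v)"
proof -
  define \<mu> where "\<mu> = (SOME \<mu>. moutard_lift \<Sigma> s \<eta> \<mu>)"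
  have lift: "moutard_lift \<Sigma> s \<eta> \<mu>" unfolding \<mu>_def using ex by (rule someI_ex)
  have label: "edge_label \<Sigma> B s \<eta> i j = 1 / ereal (B (\<mu> i) (\<mu> j))" for i j
    by (simp add: edge_label_def \<mu>_def Let_def)
  have ta: "t * B (\<mu> i) (\<mu> j) \<noteq> 1" if "edge \<Sigma> i j" for i j
  proof
    assume *: "t * B (\<mu> i) (\<mu> j) = 1"
    then have ne: "B (\<mu> i) (\<mu> j) \<noteq> 0" by auto
    then have "t = 1 / B (\<mu> i) (\<mu> j)" using * by (simp add: field_simps)
    then show False using ne t[OF that] label by (simp add: one_ereal_def)
  qed
  have step: "calapso_connection \<Sigma> B s \<eta> t j i = calapso_step B t (\<mu> i) (\<mu> j)"
    if e: "edge \<Sigma> i j" for i j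
  proof -
    let ?a = "B (\<mu> i) (\<mu> j)"
    note sp = moutard_lift_line(1)[OF iso lift] and null = moutard_lift_line(2)[OF iso lift]
    note ij = edge_in[OF e]
    show ?thesis
    proof (cases "?a = 0")
      case False
      then have "edge_label \<Sigma> B s \<eta> i j = ereal (1 / ?a)"
        using label by (simp add: one_ereal_def)
      then show ?thesis
        using calapso_eigenmap_unique[OF bil sym null[OF ij(1)] null[OF ij(2)] False ta[OF e]]
        by (simp add: calapso_connection_def sp[OF ij(1)] sp[OF ij(2)])
    next
      case True
      let ?A = "\<lambda>v. t *\<^sub>R skew_map B (\<eta> j i) v"
      have "\<eta> j i = mvec (\<mu> j) \<and>\<^sub>e mvec (\<mu> i)" using lift e unfolding moutard_lift_def by blast
      then have A: "?A v = t *\<^sub>R (B (\<mu> j) v *\<^sub>R \<mu> i - B (\<mu> i) v *\<^sub>R \<mu> j)" for v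
        by (simp add: skew_map_wedge[OF bil])
      have "?A (?A v) = 0" for v
        unfolding A using True sym[of "\<mu> j" "\<mu> i"]
        by (simp add: bilinear_rules[OF bil] null[OF ij(1)] null[OF ij(2)])
      moreover have "?A 0 = 0"
        unfolding A by (simp add: bilinear_rzero[OF bil])
      ultimately have exp: "exp_map ?A v = v + ?A v" for v
        by (intro exp_map_square_zero)
      have "edge_label \<Sigma> B s \<eta> i j = \<infinity>"
        using label True by (simp add: one_ereal_def)
      then have "calapso_connection \<Sigma> B s \<eta> t j i v = v + ?A v" for v
        by (simp add: calapso_connection_def exp)
      then show ?thesis
        unfolding A using True by (simp add: fun_eq_iff calapso_step_def algebra_simps)
    qed
  qed
  have "T i v = T j (calapso_step B t (\<mu> i) (\<mu> j) v)" if e: "edge \<Sigma> i j" for i j v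
  proof -
    have "bij (T j)" using gauge edge_in[OF e] by (auto simp: calapso_gauge_def O_group_def)
    moreover have "calapso_step B t (\<mu> i) (\<mu> j) v = inv (T j) (T i v)"
      using gauge e step[OF e] by (metis calapso_gauge_def comp_apply)
    ultimately show ?thesis by (simp add: bij_is_surj surj_f_inv_f)
  qed
  then show ?thesis using that lift ta by blast
qed

section \<open>The Moutard equation under the Calapso transform\<close>

text \<open>Both \<open>i - k\<close> and its multiple \<open>l - j\<close> are differences of null vectors, hence orthogonal to
  \<open>i + k\<close> and to \<open>l + j\<close>. The two resulting equations say that opposite edges have equal labels;
  pairing the Moutard equation with \<open>j\<close> gives the diagonal.\<close>

lemma moutard_labels:
  fixes B :: "'n::finite bform"
  assumes bil: "bilinear B" and sym: "\<And>x y. B x y = B y x"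
    and null: "B i i = 0" "B j j = 0" "B k k = 0" "B l l = 0"
    and moutard: "l - j = e *\<^sub>R (i - k)" and e: "e \<noteq> 0"
  shows "B l k = B i j" "B i l = B j k" "B j l = e * (B i j - B j k)"
proof -
  have l: "l = j + e *\<^sub>R i - e *\<^sub>R k" using moutard by (simp add: algebra_simps)
  have "B (i - k) (i + k) = 0"
    using sym[of k i] by (simp add: bilinear_rules[OF bil] null)
  then have "B (l - j) (i + k) = 0"
    unfolding moutard bilinear_lmul[OF bil] by simp
  then have 1: "B l i + B l k = B j i + B j k" by (simp add: bilinear_rules[OF bil])
  have "B (l - j) (l + j) = 0"
    using sym[of j l] by (simp add: bilinear_rules[OF bil] null)
  then have "B (i - k) (l + j) = 0"
    unfolding moutard bilinear_lmul[OF bil] using e by simp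
  then have 2: "B i l + B i j = B k l + B k j" by (simp add: bilinear_rules[OF bil])
  show "B l k = B i j" "B i l = B j k"
    using 1 2 sym[of l i] sym[of k l] sym[of j i] sym[of k j] by linarith+
  show "B j l = e * (B i j - B j k)"
    unfolding l using sym[of j i] by (simp add: bilinear_rules[OF bil] null algebra_simps)
qed

text \<open>Transported to the fibre over \<open>j\<close>, the points are \<open>\<alpha> i\<close>, \<open>j\<close>, \<open>\<beta> k\<close> and
  \<open>\<beta> (l + t \<alpha> (j, l) i - t b j)\<close>, where \<open>a\<close> and \<open>b\<close> are the inverse labels of \<open>ij\<close> and \<open>jk\<close> and
  \<open>\<alpha> = 1 / (1 - t a)\<close>, \<open>\<beta> = 1 / (1 - t b)\<close>. Substituting \<open>l\<close> from the Moutard equation and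
  \<open>(j, l) = e (a - b)\<close>, the terms in \<open>j\<close> cancel, and \<open>1 + t \<alpha> (a - b) = \<alpha> / \<beta>\<close> gives the
  coefficient of \<open>i\<close>.\<close>

lemma calapso_preserves_moutard:
  fixes B :: "'n::finite bform"
  assumes bil: "bilinear B" and sym: "\<And>x y. B x y = B y x"
    and null: "B i i = 0" "B j j = 0" "B k k = 0" "B l l = 0"
    and moutard: "l - j = e *\<^sub>R (i - k)" and e: "e \<noteq> 0"
    and t: "t * B i j \<noteq> 1" "t * B j k \<noteq> 1"
    and lin: "linear Tj"
    and ij: "\<And>v. Ti v = Tj (calapso_step B t i j v)"
    and kj: "\<And>v. Tk v = Tj (calapso_step B t k j v)"
    and li: "\<And>v. Tl v = Ti (calapso_step B t l i v)"
  shows "Tl l - Tj j = e *\<^sub>R (Ti i - Tk k)"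
proof -
  note labels = moutard_labels[OF bil sym null moutard e]
  define a where "a = B i j"
  define b where "b = B j k"
  define \<alpha> where "\<alpha> = 1 / (1 - t * a)"
  define \<beta> where "\<beta> = 1 / (1 - t * b)"
  have \<alpha>: "\<alpha> * (1 - t * a) = 1" and \<beta>: "\<beta> * (1 - t * b) = 1"
    using t by (simp_all add: \<alpha>_def \<beta>_def a_def b_def)
  note own = calapso_step_self[where B = B, OF sym]
  have Tii: "Ti i = Tj (\<alpha> *\<^sub>R i)"
    using own[OF null(1) t(1)] by (simp add: ij \<alpha>_def a_def)
  have Tkk: "Tk k = Tj (\<beta> *\<^sub>R k)"
    using own[OF null(3), where w = j] t(2) sym[of k j] by (simp add: kj \<beta>_def b_def)
  have "calapso_step B t l i l = \<beta> *\<^sub>R l"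
    using own[OF null(4), where w = i] t(2) labels(2) sym[of l i] by (simp add: \<beta>_def b_def)
  then have "Tl l = Tj (\<beta> *\<^sub>R calapso_step B t i j l)"
    using linear_calapso_step[OF bil, of t i j] by (simp add: li ij linear_cmul)
  also have "calapso_step B t i j l = l + (t * \<alpha> * (e * (a - b))) *\<^sub>R i - (t * b) *\<^sub>R j"
    using labels by (simp add: calapso_step_def \<alpha>_def a_def b_def)
  finally have Tll: "Tl l = Tj (\<beta> *\<^sub>R (l + (t * \<alpha> * (e * (a - b))) *\<^sub>R i - (t * b) *\<^sub>R j))" .
  have l: "l = j + e *\<^sub>R i - e *\<^sub>R k" using moutard by (simp add: algebra_simps)
  have "\<beta> *\<^sub>R (l + (t * \<alpha> * (e * (a - b))) *\<^sub>R i - (t * b) *\<^sub>R j) - j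
      = (\<beta> * (1 - t * b) - 1) *\<^sub>R j + (e * (\<beta> * (1 + t * \<alpha> * (a - b)))) *\<^sub>R i - (e * \<beta>) *\<^sub>R k"
    unfolding l by (simp add: algebra_simps)
  also have "1 + t * \<alpha> * (a - b) = \<alpha> * (1 - t * b)"
    using \<alpha> by (simp add: algebra_simps)
  also have "\<beta> * (\<alpha> * (1 - t * b)) = \<alpha>"
    using \<beta> by (metis mult.left_commute mult.right_neutral)
  also have "(\<beta> * (1 - t * b) - 1) *\<^sub>R j + (e * \<alpha>) *\<^sub>R i - (e * \<beta>) *\<^sub>R k = e *\<^sub>R (\<alpha> *\<^sub>R i - \<beta> *\<^sub>R k)"
    using \<beta> by (simp add: algebra_simps)
  finally have "Tj (\<beta> *\<^sub>R (l + (t * \<alpha> * (e * (a - b))) *\<^sub>R i - (t * b) *\<^sub>R j) - j)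
      = Tj (e *\<^sub>R (\<alpha> *\<^sub>R i - \<beta> *\<^sub>R k))"
    by simp
  then show ?thesis
    unfolding Tll Tii Tkk using lin by (simp only: linear_diff linear_cmul)
qed

text \<open>By \<open>wedge_quad_factor\<close>, closedness of a form \<open>\<mu>\<^sub>j \<and> \<mu>\<^sub>i\<close> is equivalent to parallel diagonals,
  and \<open>T \<mu>\<close> inherits these from \<open>\<mu>\<close>.\<close>

theorem calapso_transform_closed:
  fixes B :: "'n::{finite,linorder} bform"
  assumes bil: "bilinear B" and sym: "\<And>x y. B x y = B y x"
    and iso: "isothermic_net \<Sigma> B s \<eta>" and lift: "moutard_lift \<Sigma> s \<eta> \<mu>"
    and t: "\<And>i j. edge \<Sigma> i j \<Longrightarrow> t * B (\<mu> i) (\<mu> j) \<noteq> 1"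
    and lin: "\<And>i. i \<in> \<Sigma> \<Longrightarrow> linear (T i)"
    and step: "\<And>i j v. edge \<Sigma> i j \<Longrightarrow> T i v = T j (calapso_step B t (\<mu> i) (\<mu> j) v)"
  shows "closed_form \<Sigma> (\<lambda>j i. mvec (T j (\<mu> j)) \<and>\<^sub>e mvec (T i (\<mu> i)))"
  unfolding closed_form_def
proof (intro allI impI)
  fix i j k l assume q: "quadrilateral \<Sigma> i j k l"
  note e = quadrilateral_edges[OF q]
  have in\<Sigma>: "i \<in> \<Sigma>" "j \<in> \<Sigma>" "k \<in> \<Sigma>" "l \<in> \<Sigma>"
    using q by (auto simp: quadrilateral_def)
  note line = moutard_lift_line(1)[OF iso lift] and null = moutard_lift_line(2)[OF iso lift]
  have \<eta>: "\<eta> y x = mvec (\<mu> y) \<and>\<^sub>e mvec (\<mu> x)" if "edge \<Sigma> x y" for x y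
    using lift that unfolding moutard_lift_def by blast
  have "\<eta> i l + \<eta> l k + \<eta> k j + \<eta> j i = 0"
    using iso q unfolding isothermic_net_def closed_form_def by blast
  then have "mvec (\<mu> i - \<mu> k) \<and>\<^sub>e mvec (\<mu> l - \<mu> j) = 0"
    using \<eta>[OF e(1)] \<eta>[OF e(2)] \<eta>[OF edge_sym[OF e(3)]] \<eta>[OF edge_sym[OF e(4)]]
      wedge_quad_factor[of "\<mu> i" "\<mu> l" "\<mu> k" "\<mu> j"] by simp
  moreover have distinct: "distinct [s i, s j, s k, s l]"
    using iso q unfolding isothermic_net_def regular_net_def by blast
  then have "\<mu> i \<noteq> \<mu> k" "\<mu> l \<noteq> \<mu> j" using line in\<Sigma> by auto
  ultimately obtain c where c: "\<mu> l - \<mu> j = c *\<^sub>R (\<mu> i - \<mu> k)"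
    using wedge_mvec_eq_0_imp_multiple by (metis eq_iff_diff_eq_0)
  then have "c \<noteq> 0" using \<open>\<mu> l \<noteq> \<mu> j\<close> by auto
  then have "T l (\<mu> l) - T j (\<mu> j) = c *\<^sub>R (T i (\<mu> i) - T k (\<mu> k))"
    using calapso_preserves_moutard[OF bil sym null null null null c, of t "T j" "T i" "T k" "T l"]
      in\<Sigma> lin step e edge_sym t by blast
  then show "mvec (T i (\<mu> i)) \<and>\<^sub>e mvec (T l (\<mu> l)) + mvec (T l (\<mu> l)) \<and>\<^sub>e mvec (T k (\<mu> k))
      + mvec (T k (\<mu> k)) \<and>\<^sub>e mvec (T j (\<mu> j)) + mvec (T j (\<mu> j)) \<and>\<^sub>e mvec (T i (\<mu> i)) = 0"
    unfolding wedge_quad_factor by (simp add: mvec_scaleR wedge_scaleR_right wedge_mvec_self)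
qed

section \<open>The transformed Legendre map\<close>

theorem proposition5p5:
  fixes N p q :: nat
    and \<Sigma> :: "point set"
    and B :: "'n::{finite,linorder} bform"
    and f sp sm ft :: "'n net"
    and \<eta>p \<eta>m \<eta> :: "'n bivector_form"
    and s st :: "'n net"
    and t :: real
    and T :: "point \<Rightarrow> 'n rvec \<Rightarrow> 'n rvec"
  assumes "p \<ge> 1" and "q \<ge> 1"
    and "has_signature B (p + 1) (q + 1)"
    and "\<Sigma> \<subseteq> lattice_points N" and "simply_connected_domain \<Sigma>"
    and "applicable_legendre \<Sigma> B f"
    and "isotropic_darboux_pair \<Sigma> B sp \<eta>p sm \<eta>m \<eta>"
    and "\<forall>i\<in>\<Sigma>. f i = sp i + sm i"
    and "s = sp \<squnion>\<^sub>n sm"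
    and "\<forall>i j. edge (prism \<Sigma>) i j \<longrightarrow> ereal t \<noteq> edge_label (prism \<Sigma>) B s \<eta> i j"
    and "calapso_gauge (prism \<Sigma>) B s \<eta> t T"
    and "\<forall>i\<in>prism \<Sigma>. st i = T i ` s i"
    and "\<forall>i\<in>\<Sigma>. ft i = st (0 # i) + st (1 # i)"
    and "regular_net (prism \<Sigma>) B st" and "regular_legendre \<Sigma> ft"
  shows "applicable_legendre \<Sigma> B ft"
proof -
  note sig = assms(3) and sc = assms(5) and appl = assms(6) and pair = assms(7)
    and f = assms(8) and s = assms(9) and t = assms(10) and gauge = assms(11)
    and st = assms(12) and ft = assms(13) and reg = assms(15)
  let ?P = "prism \<Sigma>"
  have bil: "bilinear B" and sym: "\<And>x y. B x y = B y x"
    using sig unfolding has_signature_def by blast+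
  have iso: "isothermic_net ?P B s \<eta>" and isop: "isothermic_net \<Sigma> B sp \<eta>p"
    and base: "\<And>i j. edge \<Sigma> i j \<Longrightarrow> \<eta> (0 # j) (0 # i) = \<eta>p j i"
    using pair s unfolding isotropic_darboux_pair_def by blast+
  obtain \<mu>p where "moutard_lift \<Sigma> sp \<eta>p \<mu>p"
    using moutard_lift_exists[OF sc isop] by blast
  then have "\<exists>\<mu>. moutard_lift ?P s \<eta> \<mu>"
    using moutard_lift_prism[where \<eta>p = \<eta>p, OF _ base] iso unfolding s by blast
  then obtain \<mu> where lift: "moutard_lift ?P s \<eta> \<mu>"
    and t\<mu>: "\<And>x y. edge ?P x y \<Longrightarrow> t * B (\<mu> x) (\<mu> y) \<noteq> 1"
    and step: "\<And>x y v. edge ?P x y \<Longrightarrow> T x v = T y (calapso_step B t (\<mu> x) (\<mu> y) v)"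
    using calapso_gauge_steps[OF bil sym iso _ _ gauge] t by metis
  have T: "linear (T x)" "inj (T x)" "B (T x v) (T x w) = B v w" if "x \<in> ?P" for x v w
    using gauge that unfolding calapso_gauge_def O_group_def by (auto simp: bij_is_inj)
  have T_eq_0: "T x v = 0 \<longleftrightarrow> v = 0" if "x \<in> ?P" for x v
    using T(1,2)[OF that] by (metis linear_injective_0 linear_0)
  have T_fixed: "T x v = T y v" if "edge ?P x y" "B (\<mu> x) v = 0" "B (\<mu> y) v = 0" for x y v
    using step[OF that(1), of v] that(2,3) by (simp add: calapso_step_def)
  note \<mu>_null = moutard_lift_line(2)[OF iso lift]
  have sub: "subspace (s x)" if "x \<in> ?P" for x
    using iso that unfolding isothermic_net_def quadric_def by blast
  have s_f: "f i = s (0 # i) + s (1 # i)" if "i \<in> \<Sigma>" for i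
    using f that s by (simp add: join_def)
  have s_sub: "s (0 # i) \<subseteq> f i" "s (1 # i) \<subseteq> f i" if i: "i \<in> \<Sigma>" for i
  proof -
    have "0 \<in> s (0 # i)" "0 \<in> s (1 # i)" using sub i by (auto intro: subspace_0)
    then show "s (0 # i) \<subseteq> f i" "s (1 # i) \<subseteq> f i"
      unfolding s_f[OF i] by (force simp: set_plus_def)+
  qed
  have \<mu>_f: "\<mu> (0 # i) \<in> f i" "\<mu> (1 # i) \<in> f i" if "i \<in> \<Sigma>" for i
    using s_sub[OF that] lift that unfolding moutard_lift_def by auto
  have f_plane: "subspace (f i)" "dim (f i) = 2" if "i \<in> \<Sigma>" for i
    using appl that unfolding applicable_legendre_def legendre_map_def null_planes_def by blast+
  have f_null: "B v w = 0" if "v \<in> f i" "w \<in> f i" "i \<in> \<Sigma>" for v w i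
    using appl that unfolding applicable_legendre_def legendre_map_def null_planes_def by blast
  have ft_f: "ft i = T (0 # i) ` f i" if i: "i \<in> \<Sigma>" for i
  proof -
    have "T (1 # i) v = T (0 # i) v" if "v \<in> f i" for v
      using T_fixed[OF edge_prism_vertical[OF i]] f_null[OF _ that i] \<mu>_f[OF i] by simp
    then have "st (1 # i) = T (0 # i) ` s (1 # i)"
      using st i s_sub[OF i] by (auto intro!: image_cong)
    moreover have "T (0 # i) ` (s (0 # i) + s (1 # i)) = T (0 # i) ` s (0 # i) + T (0 # i) ` s (1 # i)"
      using T(1)[of "0 # i"] i by (auto simp: set_plus_def linear_add image_iff; metis linear_add)
    ultimately show ?thesis using ft st i s_f[OF i] by simp
  qed
  have common: "T (0 # i) v = T (0 # j) v" if "edge \<Sigma> i j" "v \<in> f i" "v \<in> f j" for i j v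
  proof -
    have "B (\<mu> (0 # i)) v = 0" "B (\<mu> (0 # j)) v = 0"
      using that f_null \<mu>_f edge_in by blast+
    then show ?thesis using T_fixed[OF edge_prism_horizontal[OF that(1)], of 0 v] by simp
  qed
  have common_ft: "T (0 # i) v \<in> ft i \<inter> ft j" if "edge \<Sigma> i j" "v \<in> f i" "v \<in> f j" for i j v
    using common[OF that] that edge_in ft_f by (metis IntI image_eqI)
  have common_ex: "\<exists>v. v \<noteq> 0 \<and> v \<in> f i \<and> v \<in> f j" if e: "edge \<Sigma> i j" for i j
  proof -
    have "f i \<inter> f j \<noteq> {0}"
      using appl e unfolding applicable_legendre_def legendre_map_def by blast
    moreover have "0 \<in> f i \<inter> f j" using f_plane(1) edge_in[OF e] by (auto intro: subspace_0)
    ultimately show ?thesis by blast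
  qed
  have legendre: "legendre_map \<Sigma> B ft"
    unfolding legendre_map_def
  proof (intro conjI ballI allI impI)
    fix i assume i: "i \<in> \<Sigma>"
    then have i0: "0 # i \<in> ?P" by simp
    have "subspace (ft i)"
      unfolding ft_f[OF i] by (rule linear_subspace_image[OF T(1)[OF i0] f_plane(1)[OF i]])
    moreover have "dim (ft i) = 2"
      unfolding ft_f[OF i] f_plane(2)[OF i, symmetric]
      by (rule dim_image_eq[OF T(1)[OF i0]]) (rule inj_on_subset[OF T(2)[OF i0] subset_UNIV])
    moreover have "B v w = 0" if "v \<in> ft i" "w \<in> ft i" for v w
      using that f_null i T(3)[OF i0] unfolding ft_f[OF i] by auto
    ultimately show "ft i \<in> null_planes B" by (simp add: null_planes_def)
  next
    fix i j assume e: "edge \<Sigma> i j"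
    then obtain v where v: "v \<noteq> 0" "v \<in> f i" "v \<in> f j" using common_ex by blast
    have "T (0 # i) v \<noteq> 0"
      using v(1) T_eq_0[of "0 # i"] edge_in[OF e] by simp
    then show "ft i \<inter> ft j \<noteq> {0}" using common_ft[OF e v(2,3)] by blast
  qed
  define \<nu> where "\<nu> i = T (0 # i) (\<mu> (0 # i))" for i
  define \<omega> where "\<omega> j i = mvec (\<nu> j) \<and>\<^sub>e mvec (\<nu> i)" for j i
  have "closed_form ?P (\<lambda>y x. mvec (T y (\<mu> y)) \<and>\<^sub>e mvec (T x (\<mu> x)))"
    by (rule calapso_transform_closed[OF bil sym iso lift t\<mu> T(1) step])
  then have "closed_form \<Sigma> \<omega>"
    unfolding closed_form_def \<omega>_def \<nu>_def using quadrilateral_prism_horizontal[of \<Sigma> _ _ _ _ 0] by blast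
  moreover have "one_form \<Sigma> \<omega>"
    unfolding one_form_def \<omega>_def using wedge_mvec_anti by blast
  moreover have "\<omega> i j \<in> Lambda2 (ft i + ft j)" if e: "edge \<Sigma> i j" for i j
  proof -
    have ij: "i \<in> \<Sigma>" "j \<in> \<Sigma>" using edge_in[OF e] by auto
    have "\<nu> i \<in> ft i" "\<nu> j \<in> ft j" using \<mu>_f ft_f ij by (auto simp: \<nu>_def)
    moreover have "0 \<in> ft i" "0 \<in> ft j"
      using legendre ij subspace_0 unfolding legendre_map_def null_planes_def by blast+
    ultimately have "\<nu> i + 0 \<in> ft i + ft j" "0 + \<nu> j \<in> ft i + ft j" by (blast intro: set_plus_intro)+
    then show ?thesis
      unfolding \<omega>_def Lambda2_def wedge_span_def by (auto intro!: span_base)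
  qed
  moreover have "wedge_span {\<omega> i j} (mvec ` (ft i \<inter> ft j)) \<noteq> {0}" if e: "edge \<Sigma> i j" for i j
  proof -
    have ij: "i \<in> \<Sigma>" "j \<in> \<Sigma>" using edge_in[OF e] by auto
    \<comment> \<open>It suffices that \<open>\<mu>\<^sub>0\<^sub>i\<close>, \<open>\<mu>\<^sub>0\<^sub>j\<close> and \<open>v\<close> are independent. Of these, only \<open>\<mu>\<^sub>0\<^sub>i\<close> is not orthogonal to \<open>\<mu>\<^sub>1\<^sub>j\<close>,
      and only \<open>\<mu>\<^sub>0\<^sub>j\<close> is not orthogonal to \<open>\<mu>\<^sub>1\<^sub>i\<close>.\<close>
    obtain v where v: "v \<noteq> 0" "v \<in> f i" "v \<in> f j" using common_ex[OF e] by blast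
    have diagonals: "\<not> perp B (s (0 # i)) (s (1 # j))" "\<not> perp B (s (0 # j)) (s (1 # i))"
      using iso quadrilateral_prism_vertical[OF e] unfolding isothermic_net_def regular_net_def by blast+
    note span = moutard_lift_line(1)[OF iso lift]
    have nonperp: "B (\<mu> (0 # i)) (\<mu> (1 # j)) \<noteq> 0" "B (\<mu> (0 # j)) (\<mu> (1 # i)) \<noteq> 0"
      using diagonals ij by (auto simp: span perp_def span_singleton bilinear_rules[OF bil])
    define a where "a = 1 - t * B (\<mu> (0 # j)) (\<mu> (0 # i))"
    have ji: "edge ?P (0 # j) (0 # i)" using edge_prism_horizontal[OF edge_sym[OF e]] by simp
    have a: "a \<noteq> 0" using t\<mu>[OF ji] by (simp add: a_def)
    have "calapso_step B t (\<mu> (0 # j)) (\<mu> (0 # i)) (\<mu> (0 # j)) = (1 / a) *\<^sub>R \<mu> (0 # j)"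
      unfolding a_def using ij by (intro calapso_step_self[OF sym] \<mu>_null t\<mu>[OF ji]) simp
    then have \<nu>j: "\<nu> j = T (0 # i) ((1 / a) *\<^sub>R \<mu> (0 # j))"
      using step[OF ji, of "\<mu> (0 # j)"] by (simp add: \<nu>_def)
    have "\<omega> i j \<and>\<^sub>e mvec (T (0 # i) v) \<noteq> 0"
    proof
      assume "\<omega> i j \<and>\<^sub>e mvec (T (0 # i) v) = 0"
      then obtain x y z where xyz: "x *\<^sub>R \<nu> i + y *\<^sub>R \<nu> j + z *\<^sub>R T (0 # i) v = 0"
        and nontriv: "\<not> (x = 0 \<and> y = 0 \<and> z = 0)"
        unfolding \<omega>_def by (rule wedge3_mvec_eq_0_imp_dependent)
      \<comment> \<open>Pull the relation back by \<open>T\<^sub>0\<^sub>i\<close>, under which \<open>\<nu>\<^sub>j\<close> comes from a multiple of \<open>\<mu>\<^sub>0\<^sub>j\<close>.\<close>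
      define u where "u = x *\<^sub>R \<mu> (0 # i) + (y / a) *\<^sub>R \<mu> (0 # j) + z *\<^sub>R v"
      have lin: "linear (T (0 # i))" using T(1)[of "0 # i"] ij by simp
      have "T (0 # i) u = 0"
        using xyz unfolding \<nu>j unfolding \<nu>_def u_def
        by (simp add: linear_add[OF lin] linear_cmul[OF lin])
      then have u: "u = 0" using T_eq_0[of "0 # i"] ij by simp
      have orth: "B v (\<mu> (1 # j)) = 0" "B (\<mu> (0 # j)) (\<mu> (1 # j)) = 0"
        "B v (\<mu> (1 # i)) = 0" "B (\<mu> (0 # i)) (\<mu> (1 # i)) = 0"
        using f_null \<mu>_f v ij by blast+
      have "B u (\<mu> (1 # j)) = x * B (\<mu> (0 # i)) (\<mu> (1 # j))"
        using orth by (simp add: u_def bilinear_rules[OF bil])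
      then have x: "x = 0" using u nonperp by (simp add: bilinear_lzero[OF bil])
      have "B u (\<mu> (1 # i)) = y / a * B (\<mu> (0 # j)) (\<mu> (1 # i))"
        using orth by (simp add: u_def bilinear_rules[OF bil])
      then have y: "y = 0" using u nonperp a by (simp add: bilinear_lzero[OF bil])
      have "z = 0" using u x y v(1) by (simp add: u_def)
      then show False using nontriv x y by simp
    qed
    moreover have "\<omega> i j \<and>\<^sub>e mvec (T (0 # i) v) \<in> wedge_span {\<omega> i j} (mvec ` (ft i \<inter> ft j))"
      unfolding wedge_span_def using common_ft[OF e v(2,3)] by (blast intro: span_base)
    ultimately show ?thesis by blast
  qed
  ultimately show ?thesis
    using legendre reg unfolding applicable_legendre_def by blast
qed

end
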